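(* Let $q$ be a power of a prime $p\ge 5$ and let $a\in\mathbb F_q$ be such that $f=X^6+X^5+a\in\mathbb F_q[X]$ is irreducible. If $\prod_{m\in\{2,3,6\}}\theta_{6,m}(1,0,0,0,0,a)\ne 0$ (evaluated in $\mathbb F_q$), then $f$ is normal over $\mathbb F_q$.
   Context: A monic irreducible polynomial of degree $n$ over $\mathbb F_q$ is called normal if its roots are linearly independent over $\mathbb F_q$. Let $\epsilon_m=e^{2\pi\sqrt{-1}/m}$ and $\Psi_m(X_0,\dots,X_{m-1})=\prod_{i\in(\mathbb Z/m\mathbb Z)^\times}\bigl(\sum_{j\in\mathbb Z/m\mathbb Z}\epsilon_m^{ij}X_j\bigr)\in\mathbb Z[X_0,\dots,X_{m-1}]$. For $m\mid n$ put $Y_{n,i}=\sum_{j=0}^{n/m-1}X_{i+mj}$ for $0\le i\le m-1$. Let the symmetric group $S_n$ act on $\mathbb Z[X_0,\dots,X_{n-1}]$ by permuting the indeterminates, and define $\Theta_{n,m}=\prod_\phi\phi\bigl(\Psi_m(Y_{n,0},\dots,Y_{n,m-1})\bigr)$, where $\phi$ runs over a left transversal of the stabilizer of $\Psi_m(Y_{n,0},\dots,Y_{n,m-1})$ in $S_n$; this is a symmetric polynomial in $\mathbb Z[X_0,\dots,X_{n-1}]$. Let $\theta_{n,m}\in\mathbb Z[s_1,\dots,s_n]$ be its symmetric reduction, i.e. the unique polynomial with $\Theta_{n,m}(X_0,\dots,X_{n-1})=\theta_{n,m}(s_1,\dots,s_n)$, where $s_i$ is the $i$-th elementary symmetric polynomial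 in $X_0,\dots,X_{n-1}$. Evaluation of $\theta_{n,m}$ at elements of $\mathbb F_q$ is done after reducing its integer coefficients modulo $p$. Here $n=6$. *)

theory Defs
  imports "HOL-Analysis.Analysis" "HOL-Library.Poly_Mapping"
    "HOL-Computational_Algebra.Polynomial" "HOL-Algebra.Algebraic_Closure_Type"
begin

type_synonym int_mpoly = "(nat \<Rightarrow>\<^sub>0 nat) \<Rightarrow>\<^sub>0 int"

definition mpeval :: "(nat \<Rightarrow> 'b::comm_ring_1) \<Rightarrow> int_mpoly \<Rightarrow> 'b" where
  "mpeval \<rho> P = (\<Sum>mon\<in>Poly_Mapping.keys P. of_int (Poly_Mapping.lookup P mon) * (\<Prod>i\<in>Poly_Mapping.keys mon. \<rho> i ^ Poly_Mapping.lookup mon i))"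

definition esym :: "nat \<Rightarrow> nat \<Rightarrow> (nat \<Rightarrow> complex) \<Rightarrow> complex" where
  "esym n k x = (\<Sum>S\<in>{S. S \<subseteq> {..<n} \<and> card S = k}. \<Prod>i\<in>S. x i)"

definition Psi :: "nat \<Rightarrow> (nat \<Rightarrow> complex) \<Rightarrow> complex" where
  "Psi m y = (\<Prod>i\<in>{i\<in>{..<m}. coprime i m}.
      \<Sum>j<m. cis (2 * pi / real m) ^ (i * j) * y j)"

definition Yv :: "nat \<Rightarrow> nat \<Rightarrow> (nat \<Rightarrow> complex) \<Rightarrow> nat \<Rightarrow> complex" where
  "Yv n m x i = (\<Sum>j<n div m. x (i + m * j))"

definition PsiY :: "nat \<Rightarrow> nat \<Rightarrow> (nat \<Rightarrow> complex) \<Rightarrow> complex" where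
  "PsiY n m x = Psi m (Yv n m x)"

text \<open>Theta_{n,m}: product of the distinct images of PsiY under S_n acting by
  permutation of the indeterminates (phi(X_i) = X_{phi i}). Products over the
  distinct images are exactly products over a left transversal of the stabilizer.
  Polynomials over C are identified with their polynomial functions.\<close>
definition Theta :: "nat \<Rightarrow> nat \<Rightarrow> (nat \<Rightarrow> complex) \<Rightarrow> complex" where
  "Theta n m x = (\<Prod>F\<in>{(\<lambda>z. PsiY n m (z \<circ> \<sigma>)) | \<sigma>. \<sigma> permutes {..<n}}. F x)"

text \<open>Symmetric reduction: the unique integer polynomial in s_1..s_n (variable i
  standing for s_{i+1}) with Theta = theta(s_1,...,s_n).\<close>
definition theta :: "nat \<Rightarrow> nat \<Rightarrow> int_mpoly" where
  "theta n m = (THE P. (\<forall>mon\<in>Poly_Mapping.keys P. Poly_Mapping.keys mon \<subseteq> {..<n}) \<and>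
      (\<forall>x. mpeval (\<lambda>i. esym n (i + 1) x) P = Theta n m x))"

definition normal_poly :: "'a::field poly \<Rightarrow> bool" where
  "normal_poly f \<longleftrightarrow> Polynomial.lead_coeff f = 1 \<and> Factorial_Ring.irreducible f \<and>
     (let R = {r. poly (map_poly to_ac f) r = 0} in
       card R = Polynomial.degree f \<and>
       (\<forall>c :: 'a alg_closure \<Rightarrow> 'a. (\<Sum>r\<in>R. to_ac (c r) * r) = 0 \<longrightarrow> (\<forall>r\<in>R. c r = 0)))"

end

theory Submission
  imports Defs
begin

text \<open>
  Let \<open>r\<close> be a root of \<open>f\<close> and \<open>x\<^sub>i = - r ^ (q ^ i)\<close>; these are the negatives of the six distinct
  roots, cyclically permuted by the Frobenius map, and their elementary symmetric functions are
  \<open>1, 0, 0, 0, 0, a\<close>. An \<open>F\<^sub>q\<close>-linear relation among the roots, together with its Frobenius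
  conjugates, says that a cyclic convolution with \<open>x\<close> vanishes; by the discrete Fourier transform
  (6 is invertible) it is trivial as soon as \<open>\<Sum>\<^sub>j c ^ j * x\<^sub>j \<noteq> 0\<close> for every \<open>c\<close> with
  \<open>c ^ 6 = 1\<close>. For \<open>c = 1\<close> the sum is 1. For \<open>c\<close> of order \<open>m = 2, 3, 6\<close> it divides
  \<open>\<theta>\<^sub>6\<^sub>,\<^sub>m(1, 0, 0, 0, 0, a)\<close>: the identity defining \<open>\<theta>\<close> over the complex numbers is an identity of
  integer polynomials, hence holds in every commutative ring, and \<open>\<Psi>\<^sub>m\<close> is one of the factors
  of \<open>\<Theta>\<close>. This uses that \<open>\<theta>\<close> exists (reduction of symmetric polynomials by lexicographically
  leading monomials) and is unique (every complex tuple is a tuple of elementary symmetric values).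
\<close>

section \<open>Evaluation of integer polynomials\<close>

text \<open>The inner product of \<open>mpeval\<close>, named so that its multiplicativity in the
  exponent vector can be stated.\<close>

definition monom_eval :: "(nat \<Rightarrow> 'b::comm_ring_1) \<Rightarrow> (nat \<Rightarrow>\<^sub>0 nat) \<Rightarrow> 'b" where
  "monom_eval \<rho> u = (\<Prod>i\<in>Poly_Mapping.keys u. \<rho> i ^ Poly_Mapping.lookup u i)"

definition Var :: "nat \<Rightarrow> int_mpoly" where
  "Var i = Poly_Mapping.single (Poly_Mapping.single i 1) 1"

lemma monom_eval_superset:
  assumes "finite A" "Poly_Mapping.keys u \<subseteq> A"
  shows "monom_eval \<rho> u = (\<Prod>i\<in>A. \<rho> i ^ Poly_Mapping.lookup u i)"
  unfolding monom_eval_def using assms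
  by (intro prod.mono_neutral_left) (auto simp: in_keys_iff)

lemma monom_eval_0 [simp]: "monom_eval \<rho> 0 = 1"
  by (simp add: monom_eval_def)

lemma monom_eval_single [simp]: "monom_eval \<rho> (Poly_Mapping.single i k) = \<rho> i ^ k"
  by (simp add: monom_eval_def)

lemma monom_eval_add: "monom_eval \<rho> (u + v) = monom_eval \<rho> u * monom_eval \<rho> v"
proof -
  define A where "A = Poly_Mapping.keys u \<union> Poly_Mapping.keys v"
  have "finite A" "Poly_Mapping.keys u \<subseteq> A" "Poly_Mapping.keys v \<subseteq> A"
    "Poly_Mapping.keys (u + v) \<subseteq> A"
    using keys_add[of u v] by (auto simp: A_def)
  then show ?thesis
    by (simp add: monom_eval_superset[of A] lookup_add power_add prod.distrib)
qed

lemma mpeval_superset: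
  assumes "finite A" "Poly_Mapping.keys P \<subseteq> A"
  shows "mpeval \<rho> P = (\<Sum>u\<in>A. of_int (Poly_Mapping.lookup P u) * monom_eval \<rho> u)"
  unfolding mpeval_def monom_eval_def using assms
  by (intro sum.mono_neutral_left) (auto simp: in_keys_iff)

lemma mpeval_0 [simp]: "mpeval \<rho> 0 = 0"
  by (simp add: mpeval_def)

lemma mpeval_single [simp]: "mpeval \<rho> (Poly_Mapping.single u c) = of_int c * monom_eval \<rho> u"
  by (subst mpeval_superset[of "{u}"]) auto

lemma mpeval_add [simp]: "mpeval \<rho> (P + Q) = mpeval \<rho> P + mpeval \<rho> Q"
proof -
  define A where "A = Poly_Mapping.keys P \<union> Poly_Mapping.keys Q"
  have "finite A" "Poly_Mapping.keys P \<subseteq> A" "Poly_Mapping.keys Q \<subseteq> A"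
    "Poly_Mapping.keys (P + Q) \<subseteq> A"
    using keys_add[of P Q] by (auto simp: A_def)
  then show ?thesis
    by (simp add: mpeval_superset[of A] lookup_add sum.distrib algebra_simps)
qed

lemma mpeval_sum: "mpeval \<rho> (\<Sum>i\<in>I. P i) = (\<Sum>i\<in>I. mpeval \<rho> (P i))"
  by (induction I rule: infinite_finite_induct) auto

lemma mpeval_uminus [simp]: "mpeval \<rho> (- P) = - mpeval \<rho> P"
  using mpeval_add[of \<rho> P "- P"] by (simp add: eq_neg_iff_add_eq_0 add.commute)

lemma mpeval_diff [simp]: "mpeval \<rho> (P - Q) = mpeval \<rho> P - mpeval \<rho> Q"
  using mpeval_add[of \<rho> P "- Q"] by simp

lemma poly_mapping_as_sum:
  fixes P :: "'a \<Rightarrow>\<^sub>0 'c::comm_monoid_add"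
  shows "P = (\<Sum>u\<in>Poly_Mapping.keys P. Poly_Mapping.single u (Poly_Mapping.lookup P u))"
proof (rule poly_mapping_eqI)
  fix v
  have "(\<Sum>u\<in>Poly_Mapping.keys P. Poly_Mapping.lookup (Poly_Mapping.single u (Poly_Mapping.lookup P u)) v)
     = (\<Sum>u\<in>Poly_Mapping.keys P. if u = v then Poly_Mapping.lookup P v else 0)"
    by (intro sum.cong) (auto simp: lookup_single)
  also have "\<dots> = Poly_Mapping.lookup P v"
    by (auto simp: in_keys_iff)
  finally show "Poly_Mapping.lookup P v = Poly_Mapping.lookup
      (\<Sum>u\<in>Poly_Mapping.keys P. Poly_Mapping.single u (Poly_Mapping.lookup P u)) v"
    by (simp add: lookup_sum)
qed

lemma mpeval_mult [simp]: "mpeval \<rho> (P * Q) = mpeval \<rho> P * mpeval \<rho> Q"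
proof -
  let ?s = "\<lambda>P u. Poly_Mapping.single u (Poly_Mapping.lookup P u)"
  have "P * Q = (\<Sum>u\<in>Poly_Mapping.keys P. ?s P u) * (\<Sum>v\<in>Poly_Mapping.keys Q. ?s Q v)"
    by (simp flip: poly_mapping_as_sum)
  also have "\<dots> = (\<Sum>u\<in>Poly_Mapping.keys P. \<Sum>v\<in>Poly_Mapping.keys Q.
      Poly_Mapping.single (u + v) (Poly_Mapping.lookup P u * Poly_Mapping.lookup Q v))"
    by (simp add: sum_product mult_single)
  also have "mpeval \<rho> \<dots> = (\<Sum>u\<in>Poly_Mapping.keys P. mpeval \<rho> (?s P u)) *
      (\<Sum>v\<in>Poly_Mapping.keys Q. mpeval \<rho> (?s Q v))"
    by (simp add: sum_product mpeval_sum monom_eval_add algebra_simps)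
  also have "\<dots> = mpeval \<rho> P * mpeval \<rho> Q"
    by (simp only: mpeval_sum[symmetric] poly_mapping_as_sum[symmetric])
  finally show ?thesis .
qed

lemma mpeval_1 [simp]: "mpeval \<rho> 1 = 1"
  using mpeval_single[of \<rho> 0 1] by simp

lemma mpeval_of_int [simp]: "mpeval \<rho> (of_int c) = of_int c"
  using mpeval_single[of \<rho> 0 "of_int c"] by (simp only: single_of_int) simp

lemma mpeval_power [simp]: "mpeval \<rho> (P ^ k) = mpeval \<rho> P ^ k"
  by (induction k) auto

lemma mpeval_prod: "mpeval \<rho> (\<Prod>i\<in>I. P i) = (\<Prod>i\<in>I. mpeval \<rho> (P i))"
  by (induction I rule: infinite_finite_induct) auto

lemma mpeval_Var [simp]: "mpeval \<rho> (Var i) = \<rho> i"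
  by (simp add: Var_def)

text \<open>\<open>int_mpoly\<close> is itself a commutative ring, so \<open>mpeval\<close> also
  serves as substitution of polynomials for variables; this rule composes the two uses.\<close>

lemma mpeval_mpeval: "mpeval \<rho> (mpeval \<sigma> P) = mpeval (\<lambda>i. mpeval \<rho> (\<sigma> i)) P"
  unfolding mpeval_superset[OF finite_keys order_refl, of _ P] monom_eval_def
  by (simp add: mpeval_sum mpeval_prod)

lemma monom_eval_Var: "monom_eval Var u = Poly_Mapping.single u 1"
proof -
  have pow: "Var i ^ k = Poly_Mapping.single (Poly_Mapping.single i k) 1" for i k
    by (induction k) (auto simp: Var_def mult_single simp flip: single_add)
  have "(\<Prod>i\<in>I. Poly_Mapping.single (f i) (1::int)) = Poly_Mapping.single (\<Sum>i\<in>I. f i) 1"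
    for I :: "nat set" and f :: "nat \<Rightarrow> nat \<Rightarrow>\<^sub>0 nat"
    by (induction I rule: infinite_finite_induct) (auto simp: mult_single)
  then show ?thesis
    by (simp add: monom_eval_def pow flip: poly_mapping_as_sum)
qed

lemma mpeval_Var_id [simp]: "mpeval Var P = P"
proof -
  have "mpeval Var P = (\<Sum>u\<in>Poly_Mapping.keys P. Poly_Mapping.single u (Poly_Mapping.lookup P u))"
    unfolding mpeval_superset[OF finite_keys order_refl]
    by (intro sum.cong) (auto simp: monom_eval_Var mult_single simp flip: single_of_int)
  then show ?thesis by (simp flip: poly_mapping_as_sum)
qed

text \<open>Kronecker substitution: for \<open>B\<close> larger than every exponent, replacing the \<open>i\<close>-th variable
  by \<open>T ^ (B ^ i)\<close> sends distinct monomials to distinct powers of \<open>T\<close>.\<close>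

lemma digits_unique:
  fixes a b :: "nat \<Rightarrow> nat"
  assumes "\<And>i. i < n \<Longrightarrow> a i < B" "\<And>i. i < n \<Longrightarrow> b i < B"
    and "(\<Sum>i<n. a i * B ^ i) = (\<Sum>i<n. b i * B ^ i)" and "i < n"
  shows "a i = b i"
  using assms
proof (induction n arbitrary: a b i)
  case (Suc n)
  have expand: "(\<Sum>i<Suc n. c i * B ^ i) = c 0 + B * (\<Sum>i<n. c (Suc i) * B ^ i)" for c :: "nat \<Rightarrow> nat"
    unfolding sum.lessThan_Suc_shift by (simp add: sum_distrib_left algebra_simps)
  have eq: "a 0 + B * (\<Sum>i<n. a (Suc i) * B ^ i) = b 0 + B * (\<Sum>i<n. b (Suc i) * B ^ i)"
    using Suc.prems(3) unfolding expand .
  have lt: "a 0 < B" "b 0 < B" using Suc.prems by auto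
  have "a 0 = b 0" using arg_cong[OF eq, of "\<lambda>x. x mod B"] lt by simp
  moreover have "a (Suc j) = b (Suc j)" if "j < n" for j
  proof (rule Suc.IH[of "\<lambda>j. a (Suc j)" "\<lambda>j. b (Suc j)"])
    show "(\<Sum>i<n. a (Suc i) * B ^ i) = (\<Sum>i<n. b (Suc i) * B ^ i)"
      using eq \<open>a 0 = b 0\<close> lt by simp
  qed (use Suc.prems that in auto)
  ultimately show ?case using Suc.prems(4) by (cases i) auto
qed auto

text \<open>The Kronecker image \<open>K\<close> vanishes at every complex number and so is zero; as
  \<open>code\<close> is injective on the monomials of \<open>P\<close>, every coefficient of
  \<open>P\<close> is a coefficient of \<open>K\<close>.\<close>

lemma mpoly_eq_0_if_vanishes:
  assumes "\<And>x :: nat \<Rightarrow> complex. mpeval x P = 0"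
  shows "P = 0"
proof -
  define U where "U = Poly_Mapping.keys P"
  \<comment> \<open>Inserting 0 keeps \<open>Max\<close> defined when no variable occurs;
    \<open>Suc\<close> makes the bounds strict.\<close>
  define n where "n = Suc (Max (insert 0 (\<Union>u\<in>U. Poly_Mapping.keys u)))"
  define B where "B = Suc (Max (insert 0 (\<Union>u\<in>U. Poly_Mapping.lookup u ` Poly_Mapping.keys u)))"
  define code where "code u = (\<Sum>i<n. Poly_Mapping.lookup u i * B ^ i)" for u :: "nat \<Rightarrow>\<^sub>0 nat"
  have fin: "finite U" by (simp add: U_def)
  have keys: "Poly_Mapping.keys u \<subseteq> {..<n}" if "u \<in> U" for u
    using that fin unfolding n_def by (auto simp: less_Suc_eq_le intro!: Max_ge)
  have bound: "Poly_Mapping.lookup u i < B" if "u \<in> U" for u i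
  proof (cases "i \<in> Poly_Mapping.keys u")
    case True
    then show ?thesis using that fin unfolding B_def
      by (auto simp: less_Suc_eq_le intro!: Max_ge)
  qed (auto simp: in_keys_iff B_def)
  have inj: "inj_on code U"
  proof (rule inj_onI)
    fix u v assume uv: "u \<in> U" "v \<in> U" "code u = code v"
    show "u = v"
    proof (rule poly_mapping_eqI)
      fix i
      show "Poly_Mapping.lookup u i = Poly_Mapping.lookup v i"
      proof (cases "i < n")
        case True
        show ?thesis
          by (rule digits_unique[OF _ _ _ True, where B = B])
            (use uv bound in \<open>simp_all add: code_def\<close>)
      next
        case False
        then have "i \<notin> Poly_Mapping.keys u" "i \<notin> Poly_Mapping.keys v"
          using keys[OF uv(1)] keys[OF uv(2)] by auto
        then show ?thesis by (simp add: in_keys_iff)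
      qed
    qed
  qed
  define K :: "complex poly" where
    "K = (\<Sum>u\<in>U. Polynomial.monom (of_int (Poly_Mapping.lookup P u)) (code u))"
  have "poly K t = 0" for t
  proof -
    have "monom_eval (\<lambda>i. t ^ (B ^ i)) u = t ^ code u" if "u \<in> U" for u
      by (simp add: monom_eval_superset[OF _ keys[OF that]] code_def power_sum mult.commute
          flip: power_mult)
    then have "mpeval (\<lambda>i. t ^ (B ^ i)) P = poly K t"
      by (simp add: mpeval_superset[OF fin] K_def U_def poly_sum poly_monom)
    then show ?thesis using assms by simp
  qed
  then have "K = 0" using poly_all_0_iff_0 by blast
  have "Poly_Mapping.lookup P u = 0" if "u \<in> U" for u
  proof -
    have "Polynomial.coeff K (code u) = (\<Sum>v\<in>U. if v = u then of_int (Poly_Mapping.lookup P u) else 0)"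
      unfolding K_def Polynomial.coeff_sum using inj that
      by (intro sum.cong) (auto simp: inj_on_def)
    then show ?thesis using that fin \<open>K = 0\<close> by simp
  qed
  then show ?thesis
    by (intro poly_mapping_eqI) (auto simp: U_def in_keys_iff)
qed

lemma mpoly_eqI_complex:
  assumes "\<And>x :: nat \<Rightarrow> complex. mpeval x P = mpeval x Q"
  shows "P = Q"
  using mpoly_eq_0_if_vanishes[of "P - Q"] assms by simp

section \<open>Symmetric polynomials\<close>

text \<open>Identifies \<open><\<close> on exponent vectors as the lexicographic order with variable
  0 most significant; it serves as the monomial order below.\<close>

lemma poly_mapping_less_iff:
  fixes u v :: "'a::linorder \<Rightarrow>\<^sub>0 'b::{zero,linorder}"
  shows "u < v \<longleftrightarrow> (\<exists>k. Poly_Mapping.lookup u k < Poly_Mapping.lookup v k \<and>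
    (\<forall>j<k. Poly_Mapping.lookup u j = Poly_Mapping.lookup v j))"
  by (simp add: less_poly_mapping.rep_eq less_fun_def)

section \<open>Polynomials in the first \<open>n\<close> variables\<close>

definition vars_below :: "nat \<Rightarrow> int_mpoly \<Rightarrow> bool" where
  "vars_below n P \<longleftrightarrow> (\<forall>u\<in>Poly_Mapping.keys P. Poly_Mapping.keys u \<subseteq> {..<n})"

lemma vars_below_add: "vars_below n P \<Longrightarrow> vars_below n Q \<Longrightarrow> vars_below n (P + Q)"
  using keys_add[of P Q] by (auto simp: vars_below_def)

lemma vars_below_diff: "vars_below n P \<Longrightarrow> vars_below n Q \<Longrightarrow> vars_below n (P - Q)"
  using keys_diff[of P Q] by (auto simp: vars_below_def)

lemma vars_below_mult:
  assumes "vars_below n P" "vars_below n Q"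
  shows "vars_below n (P * Q)"
  unfolding vars_below_def
proof
  fix w assume "w \<in> Poly_Mapping.keys (P * Q)"
  then obtain u v where "w = u + v" "u \<in> Poly_Mapping.keys P" "v \<in> Poly_Mapping.keys Q"
    using keys_mult[of P Q] by auto
  then show "Poly_Mapping.keys w \<subseteq> {..<n}"
    using assms keys_add[of u v] unfolding vars_below_def by blast
qed

lemma vars_below_0 [simp]: "vars_below n 0"
  by (simp add: vars_below_def)

lemma vars_below_1 [simp]: "vars_below n 1"
  by (simp add: vars_below_def)

lemma of_int_eq_single: "(of_int c :: int_mpoly) = Poly_Mapping.single 0 c"
  by (simp flip: single_of_int)

lemma vars_below_of_int [simp]: "vars_below n (of_int c)"
  by (simp add: vars_below_def of_int_eq_single)

lemma vars_below_Var [simp]: "vars_below n (Var i) \<longleftrightarrow> i < n"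
  by (simp add: vars_below_def Var_def)

lemma vars_below_power: "vars_below n P \<Longrightarrow> vars_below n (P ^ k)"
  by (induction k) (auto intro: vars_below_mult)

lemma vars_below_sum: "(\<And>i. i \<in> I \<Longrightarrow> vars_below n (P i)) \<Longrightarrow> vars_below n (\<Sum>i\<in>I. P i)"
  by (induction I rule: infinite_finite_induct) (auto intro: vars_below_add)

lemma vars_below_prod: "(\<And>i. i \<in> I \<Longrightarrow> vars_below n (P i)) \<Longrightarrow> vars_below n (\<Prod>i\<in>I. P i)"
  by (induction I rule: infinite_finite_induct) (auto intro: vars_below_mult)

lemma vars_below_mpeval: "(\<And>i. vars_below n (\<rho> i)) \<Longrightarrow> vars_below n (mpeval \<rho> P)"
  unfolding mpeval_def
  by (intro vars_below_sum vars_below_mult vars_below_prod vars_below_power vars_below_of_int)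

text \<open>A version of \<open>esym\<close> over any commutative ring: it is used over the complex
  numbers, over \<open>int_mpoly\<close> at \<open>Var\<close>, and over the algebraic
  closure.\<close>

definition elem_sym :: "nat \<Rightarrow> nat \<Rightarrow> (nat \<Rightarrow> 'b::comm_ring_1) \<Rightarrow> 'b" where
  "elem_sym n k x = (\<Sum>S\<in>{S. S \<subseteq> {..<n} \<and> card S = k}. \<Prod>i\<in>S. x i)"

lemma esym_eq_elem_sym: "esym n k x = elem_sym n k x"
  by (simp add: esym_def elem_sym_def)

lemma mpeval_elem_sym: "mpeval \<rho> (elem_sym n k \<sigma>) = elem_sym n k (\<lambda>i. mpeval \<rho> (\<sigma> i))"
  by (simp add: elem_sym_def mpeval_sum mpeval_prod)

lemma elem_sym_permute:
  assumes "\<pi> permutes {..<n}"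
  shows "elem_sym n k (x \<circ> \<pi>) = elem_sym n k x"
  unfolding elem_sym_def
proof (rule sum.reindex_bij_witness[where i = "(`) (inv_into UNIV \<pi>)" and j = "(`) \<pi>"])
  fix S assume "S \<in> {S. S \<subseteq> {..<n} \<and> card S = k}"
  then have S: "S \<subseteq> {..<n}" "card S = k" by auto
  have inj: "inj \<pi>" "inj (inv_into UNIV \<pi>)"
    using permutes_inj[OF assms] permutes_inj[OF permutes_inv[OF assms]] by auto
  show "inv_into UNIV \<pi> ` \<pi> ` S = S" "\<pi> ` inv_into UNIV \<pi> ` S = S"
    using permutes_inverses[OF assms] by (auto simp: image_image)
  show "\<pi> ` S \<in> {S. S \<subseteq> {..<n} \<and> card S = k}"
    using S permutes_image[OF assms] inj by (auto simp: card_image inj_on_subset)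
  show "inv_into UNIV \<pi> ` S \<in> {S. S \<subseteq> {..<n} \<and> card S = k}"
    using S permutes_image[OF permutes_inv[OF assms]] inj by (auto simp: card_image inj_on_subset)
  show "(\<Prod>i\<in>\<pi> ` S. x i) = (\<Prod>i\<in>S. (x \<circ> \<pi>) i)"
    using inj by (simp add: prod.reindex inj_on_subset o_def)
qed

section \<open>Lexicographically leading monomials\<close>

definition lead_monic :: "(nat \<Rightarrow>\<^sub>0 nat) \<Rightarrow> int_mpoly \<Rightarrow> bool" where
  "lead_monic M P \<longleftrightarrow> Poly_Mapping.lookup P M = 1 \<and> (\<forall>u\<in>Poly_Mapping.keys P. u \<le> M)"

lemma lead_monicE:
  assumes "lead_monic M P"
  obtains P' where "P = Poly_Mapping.single M 1 + P'" "\<forall>u\<in>Poly_Mapping.keys P'. u < M"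
proof
  show "P = Poly_Mapping.single M 1 + (P - Poly_Mapping.single M 1)" by simp
  show "\<forall>u\<in>Poly_Mapping.keys (P - Poly_Mapping.single M 1). u < M"
  proof
    fix u assume u: "u \<in> Poly_Mapping.keys (P - Poly_Mapping.single M 1)"
    then have "u \<noteq> M"
      using assms by (auto simp: in_keys_iff lookup_minus lead_monic_def)
    moreover have "u \<in> Poly_Mapping.keys P \<union> {M}"
      using u keys_diff[of P "Poly_Mapping.single M 1"] by auto
    ultimately show "u < M" using assms by (auto simp: lead_monic_def order_less_le)
  qed
qed

lemma lead_monicI:
  assumes "\<forall>u\<in>Poly_Mapping.keys P'. u < M"
  shows "lead_monic M (Poly_Mapping.single M 1 + P')"
proof -
  have "M \<notin> Poly_Mapping.keys P'" using assms by auto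
  then show ?thesis
    using assms keys_add[of "Poly_Mapping.single M 1" P']
    by (auto simp: lead_monic_def lookup_add in_keys_iff order_less_imp_le)
qed

text \<open>The order is compatible with addition, so every product of monomials other than
  \<open>M + N\<close> is strictly smaller. That the leading coefficient stays 1 keeps the later
  reduction over the integers.\<close>

lemma lead_monic_mult:
  assumes "lead_monic M P" "lead_monic N Q"
  shows "lead_monic (M + N) (P * Q)"
proof -
  obtain P' where P: "P = Poly_Mapping.single M 1 + P'" "\<forall>u\<in>Poly_Mapping.keys P'. u < M"
    using assms(1) by (rule lead_monicE)
  obtain Q' where Q: "Q = Poly_Mapping.single N 1 + Q'" "\<forall>u\<in>Poly_Mapping.keys Q'. u < N"
    using assms(2) by (rule lead_monicE)
  define R where "R = Poly_Mapping.single M 1 * Q' + P' * Q"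
  have "u < M + N" if "u \<in> Poly_Mapping.keys R" for u
  proof -
    from that consider "u \<in> Poly_Mapping.keys (Poly_Mapping.single M 1 * Q')"
      | "u \<in> Poly_Mapping.keys (P' * Q)"
      unfolding R_def using keys_add[of "Poly_Mapping.single M 1 * Q'" "P' * Q"] by blast
    then show ?thesis
    proof cases
      case 1
      then obtain v where "u = M + v" "v \<in> Poly_Mapping.keys Q'"
        using keys_mult[of "Poly_Mapping.single M (1::int)" Q'] by auto
      then show ?thesis using Q(2) by simp
    next
      case 2
      then obtain v w where "u = v + w" "v \<in> Poly_Mapping.keys P'" "w \<in> Poly_Mapping.keys Q"
        using keys_mult[of P' Q] by auto
      then show ?thesis
        using P(2) assms(2) by (auto simp: lead_monic_def intro: add_less_le_mono)
    qed
  qed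
  moreover have "P * Q = Poly_Mapping.single (M + N) 1 + R"
    by (simp add: P(1) Q(1) R_def algebra_simps mult_single)
  ultimately show ?thesis using lead_monicI by simp
qed

lemma lead_monic_1: "lead_monic 0 1"
  by (simp add: lead_monic_def)

lemma lead_monic_prod:
  "(\<And>i. i \<in> I \<Longrightarrow> lead_monic (M i) (P i)) \<Longrightarrow> lead_monic (\<Sum>i\<in>I. M i) (\<Prod>i\<in>I. P i)"
  by (induction I rule: infinite_finite_induct) (auto intro: lead_monic_mult lead_monic_1)

text \<open>The sum with constant summand expresses the \<open>k\<close>-fold multiple of
  \<open>M\<close>.\<close>

lemma lead_monic_power: "lead_monic M P \<Longrightarrow> lead_monic (\<Sum>i<k. M) (P ^ k)"
  using lead_monic_prod[of "{..<k}" "\<lambda>_. M" "\<lambda>_. P"] by simp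

definition set_monom :: "nat set \<Rightarrow> nat \<Rightarrow>\<^sub>0 nat" where
  "set_monom S = (\<Sum>i\<in>S. Poly_Mapping.single i 1)"

lemma lookup_set_monom:
  "finite S \<Longrightarrow> Poly_Mapping.lookup (set_monom S) i = (if i \<in> S then 1 else 0)"
  by (simp add: set_monom_def lookup_sum lookup_single when_def)

lemma prod_Var: "(\<Prod>i\<in>S. Var i) = Poly_Mapping.single (set_monom S) 1"
  unfolding set_monom_def Var_def
  by (induction S rule: infinite_finite_induct) (auto simp: mult_single)

text \<open>Among the \<open>k\<close>-subsets, \<open>{..<k}\<close> has the lexicographically
  largest indicator vector.\<close>

lemma lead_monic_elem_sym:
  assumes "k \<le> n"
  shows "lead_monic (set_monom {..<k}) (elem_sym n k Var)"
proof -
  define F where "F = {S. S \<subseteq> {..<n} \<and> card S = k}"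
  have finF: "finite F" unfolding F_def by (rule finite_subset[of _ "Pow {..<n}"]) auto
  have less: "set_monom S < set_monom {..<k}" if "S \<in> F - {{..<k}}" for S
  proof -
    have S: "finite S" "card S = k" "S \<noteq> {..<k}"
      using that by (auto simp: F_def intro: finite_subset)
    have ne: "{..<k} - S \<noteq> {}"
      using S card_subset_eq[of S "{..<k}"] by auto
    \<comment> \<open>The least element of \<open>{..<k}\<close> missing from \<open>S\<close> is
      the first place where the two indicator vectors differ.\<close>
    define i where "i = Min ({..<k} - S)"
    have i: "i \<in> {..<k} - S" unfolding i_def using ne by (intro Min_in) auto
    have "j \<in> S" if "j < i" for j
    proof (rule ccontr)
      assume "j \<notin> S"
      then have "i \<le> j" unfolding i_def using that i by (intro Min_le) auto
      then show False using that by simp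
    qed
    then show ?thesis unfolding poly_mapping_less_iff
      using i S by (intro exI[of _ i]) (auto simp: lookup_set_monom)
  qed
  have "{..<k} \<in> F" using assms by (auto simp: F_def)
  then have "elem_sym n k Var = Poly_Mapping.single (set_monom {..<k}) 1 +
      (\<Sum>S\<in>F - {{..<k}}. Poly_Mapping.single (set_monom S) 1)"
    unfolding elem_sym_def F_def[symmetric] prod_Var using finF by (simp add: sum.remove)
  moreover have "\<forall>u\<in>Poly_Mapping.keys (\<Sum>S\<in>F - {{..<k}}. Poly_Mapping.single (set_monom S) (1::int)).
      u < set_monom {..<k}"
    using less keys_sum[of "\<lambda>S. Poly_Mapping.single (set_monom S) (1::int)" "F - {{..<k}}"] by fastforce
  ultimately show ?thesis using lead_monicI by simp
qed

section \<open>Reduction of symmetric polynomials\<close>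

definition symmetric_mpoly :: "nat \<Rightarrow> int_mpoly \<Rightarrow> bool" where
  "symmetric_mpoly n P \<longleftrightarrow> (\<forall>\<pi>. \<pi> permutes {..<n} \<longrightarrow> mpeval (Var \<circ> \<pi>) P = P)"

text \<open>Stated for involutions because it is applied to adjacent transpositions; renaming
  variables then acts on monomials by \<open>map_key \<tau>\<close> without passing to an
  inverse.\<close>

lemma lookup_map_key_involution:
  assumes invol: "\<And>i. \<tau> (\<tau> i) = i" and fixed: "mpeval (Var \<circ> \<tau>) P = P"
  shows "Poly_Mapping.lookup P (Poly_Mapping.map_key \<tau> v) = Poly_Mapping.lookup P v"
proof -
  have inj: "inj \<tau>" using invol by (metis injI)
  have monom: "monom_eval (Var \<circ> \<tau>) u = Poly_Mapping.single (Poly_Mapping.map_key \<tau> u) 1" for u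
  proof -
    have "monom_eval (Var \<circ> \<tau>) u =
        (\<Prod>i\<in>\<tau> -` Poly_Mapping.keys u. Var i ^ Poly_Mapping.lookup u (\<tau> i))"
      unfolding monom_eval_def
      by (rule prod.reindex_bij_witness[of _ \<tau> \<tau>]) (auto simp: invol)
    also have "\<dots> = monom_eval Var (Poly_Mapping.map_key \<tau> u)"
      unfolding monom_eval_def keys_map_key[OF inj] by (simp add: map_key.rep_eq[OF inj])
    finally show ?thesis by (simp add: monom_eval_Var)
  qed
  have inj_key: "Poly_Mapping.map_key \<tau> u = Poly_Mapping.map_key \<tau> v \<longleftrightarrow> u = v" for u
  proof
    assume "Poly_Mapping.map_key \<tau> u = Poly_Mapping.map_key \<tau> v"
    from arg_cong[OF this, of "Poly_Mapping.map_key \<tau>"] show "u = v"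
      by (simp add: map_key_compose inj o_def invol map_key_id)
  qed simp
  have expand: "mpeval (Var \<circ> \<tau>) P = (\<Sum>u\<in>Poly_Mapping.keys P.
      Poly_Mapping.single (Poly_Mapping.map_key \<tau> u) (Poly_Mapping.lookup P u))"
    unfolding mpeval_superset[OF finite_keys order_refl] monom
    by (intro sum.cong) (auto simp: mult_single simp flip: single_of_int)
  have "Poly_Mapping.lookup P (Poly_Mapping.map_key \<tau> v) =
      Poly_Mapping.lookup (mpeval (Var \<circ> \<tau>) P) (Poly_Mapping.map_key \<tau> v)"
    by (simp only: fixed)
  also have "\<dots> = (\<Sum>u\<in>Poly_Mapping.keys P. if u = v then Poly_Mapping.lookup P v else 0)"
    unfolding expand
    by (auto simp: lookup_sum lookup_single when_def inj_key intro!: sum.cong)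
  finally have "Poly_Mapping.lookup P (Poly_Mapping.map_key \<tau> v) =
      (\<Sum>u\<in>Poly_Mapping.keys P. if u = v then Poly_Mapping.lookup P v else 0)" .
  then show ?thesis by (auto simp: in_keys_iff)
qed

text \<open>Otherwise exchanging the variables \<open>i\<close> and \<open>Suc i\<close> would turn
  \<open>L\<close> into a larger monomial of \<open>P\<close>.\<close>

lemma lead_exponents_antimono:
  assumes sym: "symmetric_mpoly n P" and "Suc i < n"
    and L: "L \<in> Poly_Mapping.keys P" "\<And>u. u \<in> Poly_Mapping.keys P \<Longrightarrow> u \<le> L"
  shows "Poly_Mapping.lookup L (Suc i) \<le> Poly_Mapping.lookup L i"
proof (rule ccontr)
  assume less: "\<not> ?thesis"
  define \<tau> where "\<tau> = Transposition.transpose i (Suc i)"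
  have inj: "inj \<tau>" by (simp add: \<tau>_def)
  have "\<tau> permutes {..<n}" unfolding \<tau>_def using assms by (intro permutes_swap_id) auto
  then have "mpeval (Var \<circ> \<tau>) P = P" using sym by (simp add: symmetric_mpoly_def)
  then have "Poly_Mapping.lookup P (Poly_Mapping.map_key \<tau> L) = Poly_Mapping.lookup P L"
    by (intro lookup_map_key_involution) (auto simp: \<tau>_def)
  then have "Poly_Mapping.map_key \<tau> L \<in> Poly_Mapping.keys P" using L(1) by (simp add: in_keys_iff)
  then have "Poly_Mapping.map_key \<tau> L \<le> L" by (rule L(2))
  moreover have "L < Poly_Mapping.map_key \<tau> L"
    unfolding poly_mapping_less_iff map_key.rep_eq[OF inj]
    using less by (intro exI[of _ i]) (auto simp: \<tau>_def transpose_def)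
  ultimately show False by simp
qed

text \<open>Without a bound on the variables, the variables 0, 1, 2, ... would form an infinite
  descending chain. With it, exponent vectors become lists of length \<open>n\<close>.\<close>

lemma wf_monom_lex:
  "wf {(u, v :: nat \<Rightarrow>\<^sub>0 nat). u < v \<and> Poly_Mapping.keys u \<subseteq> {..<n} \<and> Poly_Mapping.keys v \<subseteq> {..<n}}"
proof (rule wf_subset)
  let ?l = "\<lambda>u. map (Poly_Mapping.lookup u) [0..<n] :: nat list"
  show "wf (inv_image (lexn less_than n) ?l)"
    by (intro wf_inv_image wf_lexn wf_less_than)
  show "{(u, v). u < v \<and> Poly_Mapping.keys u \<subseteq> {..<n} \<and> Poly_Mapping.keys v \<subseteq> {..<n}}
      \<subseteq> inv_image (lexn less_than n) ?l"
  proof clarify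
    fix u v :: "nat \<Rightarrow>\<^sub>0 nat"
    assume uv: "u < v" "Poly_Mapping.keys v \<subseteq> {..<n}"
    then obtain k where k: "Poly_Mapping.lookup u k < Poly_Mapping.lookup v k"
      "\<And>j. j < k \<Longrightarrow> Poly_Mapping.lookup u j = Poly_Mapping.lookup v j"
      unfolding poly_mapping_less_iff by auto
    have "k \<in> Poly_Mapping.keys v" using k(1) by (simp add: in_keys_iff)
    then have "k < n" using uv by auto
    then have split: "[0..<n] = [0..<k] @ k # [Suc k..<n]"
      using upt_add_eq_append[of 0 k "n - k"] upt_conv_Cons[of k n] by simp
    have "?l u = map (Poly_Mapping.lookup v) [0..<k] @ Poly_Mapping.lookup u k #
        map (Poly_Mapping.lookup u) [Suc k..<n]"
      unfolding split using k(2) by simp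
    moreover have "?l v = map (Poly_Mapping.lookup v) [0..<k] @ Poly_Mapping.lookup v k #
        map (Poly_Mapping.lookup v) [Suc k..<n]"
      unfolding split by simp
    ultimately show "(u, v) \<in> inv_image (lexn less_than n) ?l"
      using k(1) \<open>k < n\<close> unfolding lexn_conv in_inv_image by (auto simp del: map_append)
  qed
qed

text \<open>The witness is a product of elementary symmetric polynomials whose exponents are the
  successive differences in \<open>L\<close>; in the leading monomial these telescope back to
  \<open>L\<close>.\<close>

lemma lead_monic_antimono_exists:
  assumes keys: "Poly_Mapping.keys L \<subseteq> {..<n}"
    and anti: "\<And>i. Suc i < n \<Longrightarrow> Poly_Mapping.lookup L (Suc i) \<le> Poly_Mapping.lookup L i"
  shows "\<exists>Q. vars_below n Q \<and> lead_monic L (mpeval (\<lambda>i. elem_sym n (i + 1) Var) Q)"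
proof -
  \<comment> \<open>The truncated subtraction is exact by \<open>anti\<close>; for
    \<open>i = n - 1\<close> the subtrahend is 0 by \<open>keys\<close>.\<close>
  define d where "d i = Poly_Mapping.lookup L i - Poly_Mapping.lookup L (Suc i)" for i
  define Q where "Q = (\<Prod>i<n. Var i ^ d i)"
  have zero: "Poly_Mapping.lookup L i = 0" if "i \<ge> n" for i
    using keys that by (auto simp: in_keys_iff subset_iff)
  have anti': "Poly_Mapping.lookup L (Suc i) \<le> Poly_Mapping.lookup L i" if "i < n" for i
    using anti[of i] zero[of "Suc i"] by (cases "Suc i < n") auto
  have tele: "(\<Sum>i=t..<n. d i) = Poly_Mapping.lookup L t" if "t \<le> n" for t
    using that
  proof (induction rule: inc_induct)
    case (step m)
    then show ?case using anti'[of m] by (simp add: sum.atLeast_Suc_lessThan d_def)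
  qed (simp add: zero)
  have "(\<Sum>i<n. \<Sum>_<d i. set_monom {..<i + 1}) = L"
  proof (rule poly_mapping_eqI)
    fix t
    have "Poly_Mapping.lookup (\<Sum>i<n. \<Sum>_<d i. set_monom {..<i + 1}) t =
        (\<Sum>i<n. if t \<le> i then d i else 0)"
      by (auto simp: lookup_sum lookup_set_monom less_Suc_eq_le simp del: sum_constant
          intro!: sum.cong) simp_all
    also have "\<dots> = (\<Sum>i\<in>{i\<in>{..<n}. t \<le> i}. d i)"
      by (rule sum.inter_filter[symmetric]) simp
    also have "{i\<in>{..<n}. t \<le> i} = {t..<n}" by auto
    also have "(\<Sum>i=t..<n. d i) = Poly_Mapping.lookup L t"
      using tele zero by (cases "t \<le> n") auto
    finally show "Poly_Mapping.lookup (\<Sum>i<n. \<Sum>_<d i. set_monom {..<i + 1}) t = Poly_Mapping.lookup L t" .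
  qed
  moreover have "lead_monic (\<Sum>i<n. \<Sum>_<d i. set_monom {..<i + 1})
      (mpeval (\<lambda>i. elem_sym n (i + 1) Var) Q)"
    unfolding Q_def mpeval_prod mpeval_power mpeval_Var
    by (intro lead_monic_prod lead_monic_power lead_monic_elem_sym) auto
  moreover have "vars_below n Q"
    unfolding Q_def by (intro vars_below_prod vars_below_power) auto
  ultimately show ?thesis by auto
qed

lemma symmetric_elem_sym_mpeval:
  assumes "\<pi> permutes {..<n}"
  shows "mpeval (Var \<circ> \<pi>) (mpeval (\<lambda>i. elem_sym n (f i) Var) Q) = mpeval (\<lambda>i. elem_sym n (f i) Var) Q"
  unfolding mpeval_mpeval mpeval_elem_sym mpeval_Var elem_sym_permute[OF assms] ..

text \<open>Existence half of the fundamental theorem: subtracting an integer multiple of a product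
  of elementary symmetric polynomials with the same leading monomial lowers the leading
  monomial.\<close>

theorem symmetric_mpoly_reduction:
  assumes "vars_below n P" "symmetric_mpoly n P"
  shows "\<exists>Q. vars_below n Q \<and> mpeval (\<lambda>i. elem_sym n (i + 1) Var) Q = P"
proof -
  let ?E = "mpeval (\<lambda>i. elem_sym n (i + 1) Var)"
  have red: "\<forall>P. vars_below n P \<and> symmetric_mpoly n P \<and> L \<in> Poly_Mapping.keys P \<and>
      (\<forall>u\<in>Poly_Mapping.keys P. u \<le> L) \<longrightarrow> (\<exists>Q. vars_below n Q \<and> ?E Q = P)" for L
  proof (induction L rule: wf_induct_rule[OF wf_monom_lex[of n]])
    case (1 L)
    show ?case
    proof (intro allI impI, elim conjE)
      fix P
      assume P: "vars_below n P" "symmetric_mpoly n P" "L \<in> Poly_Mapping.keys P"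
        "\<forall>u\<in>Poly_Mapping.keys P. u \<le> L"
      have keysL: "Poly_Mapping.keys L \<subseteq> {..<n}" using P by (auto simp: vars_below_def)
      obtain Q0 where Q0: "vars_below n Q0" "lead_monic L (?E Q0)"
        using lead_monic_antimono_exists[OF keysL lead_exponents_antimono[OF P(2) _ P(3)]] P(4) by blast
      define c where "c = Poly_Mapping.lookup P L"
      define P' where "P' = P - of_int c * ?E Q0"
      have keys_c: "Poly_Mapping.keys (of_int c * ?E Q0) \<subseteq> Poly_Mapping.keys (?E Q0)"
        using keys_mult[of "Poly_Mapping.single 0 c" "?E Q0"] unfolding of_int_eq_single
        by (auto split: if_splits)
      have lookup_c: "Poly_Mapping.lookup (of_int c * ?E Q0) L = c"
        using Q0(2) unfolding of_int_eq_single mult_map_scale_conv_mult[symmetric]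
        by (auto simp: lead_monic_def map.rep_eq)
      have P'_vars: "vars_below n P'" unfolding P'_def
        using P(1)
        by (auto simp: elem_sym_def intro!: vars_below_diff vars_below_mult vars_below_mpeval
            vars_below_sum vars_below_prod)
      have P'_sym: "symmetric_mpoly n P'"
        using P(2) unfolding symmetric_mpoly_def P'_def by (simp add: symmetric_elem_sym_mpeval)
      have P'_less: "u < L" if "u \<in> Poly_Mapping.keys P'" for u
      proof -
        have "u \<noteq> L" using that lookup_c by (auto simp: P'_def in_keys_iff lookup_minus c_def)
        moreover have "u \<in> Poly_Mapping.keys P \<union> Poly_Mapping.keys (?E Q0)"
          using that keys_c keys_diff[of P "of_int c * ?E Q0"] unfolding P'_def by blast
        ultimately show ?thesis
          using P(4) Q0(2) by (auto simp: lead_monic_def order_less_le)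
      qed
      have "\<exists>Q. vars_below n Q \<and> ?E Q = P'"
      \<comment> \<open>The zero polynomial has no leading monomial and ends the recursion.\<close>
      proof (cases "P' = 0")
        case True
        then show ?thesis by (intro exI[of _ 0]) auto
      next
        case False
        define L' where "L' = Max (Poly_Mapping.keys P')"
        have L': "L' \<in> Poly_Mapping.keys P'" "\<forall>u\<in>Poly_Mapping.keys P'. u \<le> L'"
          using False by (auto simp: L'_def)
        then have "(L', L) \<in> {(u, v). u < v \<and> Poly_Mapping.keys u \<subseteq> {..<n} \<and> Poly_Mapping.keys v \<subseteq> {..<n}}"
          using P'_less P'_vars keysL by (auto simp: vars_below_def)
        then show ?thesis using 1 L' P'_vars P'_sym by blast
      qed
      then obtain Q1 where "vars_below n Q1" "?E Q1 = P'" by blast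
      then show "\<exists>Q. vars_below n Q \<and> ?E Q = P"
        using Q0(1)
        by (intro exI[of _ "Q1 + of_int c * Q0"])
          (auto simp: P'_def intro!: vars_below_add vars_below_mult)
    qed
  qed
  show ?thesis
  proof (cases "P = 0")
    case True
    then show ?thesis by (intro exI[of _ 0]) auto
  next
    case False
    then show ?thesis using red[of "Max (Poly_Mapping.keys P)"] assms by auto
  qed
qed

section \<open>Vieta's formula and algebraic independence\<close>

lemma vieta:
  fixes x :: "nat \<Rightarrow> 'b::comm_ring_1"
  assumes "k \<le> n"
  shows "Polynomial.coeff (\<Prod>i<n. [:x i, 1:]) (n - k) = elem_sym n k x"
proof -
  have const_prod: "(\<Prod>i\<in>S. Polynomial.monom (x i) 0) = Polynomial.monom (\<Prod>i\<in>S. x i) 0" for S :: "nat set"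
    by (induction S rule: infinite_finite_induct) (auto simp: mult_monom one_pCons monom_0)
  have "(\<Prod>i<n. [:x i, 1:]) = (\<Prod>i<n. Polynomial.monom (x i) 0 + Polynomial.monom 1 1)"
    by (intro prod.cong) (auto simp: monom_0 monom_Suc)
  \<comment> \<open>\<open>S\<close> collects the factors that contribute their constant
    term.\<close>
  also have "\<dots> = (\<Sum>S\<in>Pow {..<n}. Polynomial.monom (\<Prod>i\<in>S. x i) (n - card S))"
    by (subst prod_add)
      (auto simp: const_prod monom_power mult_monom card_Diff_subset finite_subset intro!: sum.cong)
  finally have "Polynomial.coeff (\<Prod>i<n. [:x i, 1:]) (n - k) =
      (\<Sum>S\<in>Pow {..<n}. if n - card S = n - k then \<Prod>i\<in>S. x i else 0)"
    by (simp add: Polynomial.coeff_sum)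
  also have "\<dots> = (\<Sum>S\<in>{S \<in> Pow {..<n}. n - card S = n - k}. \<Prod>i\<in>S. x i)"
    by (rule sum.inter_filter[symmetric]) simp
  also have "{S \<in> Pow {..<n}. n - card S = n - k} = {S. S \<subseteq> {..<n} \<and> card S = k}"
  proof -
    \<comment> \<open>Truncated subtraction cancels because \<open>card S\<close> and
      \<open>k\<close> are both at most \<open>n\<close>.\<close>
    have "n - card S = n - k \<longleftrightarrow> card S = k" if "S \<subseteq> {..<n}" for S
      using card_mono[OF _ that] assms by auto
    then show ?thesis by blast
  qed
  finally show ?thesis by (simp add: elem_sym_def)
qed

text \<open>The values \<open>x i\<close> are the negated roots of the monic polynomial with the
  prescribed coefficients, which splits over the complex numbers.\<close>

lemma elem_sym_surj:
  fixes s :: "nat \<Rightarrow> complex"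
  obtains x where "\<And>k. k < n \<Longrightarrow> elem_sym n (k + 1) x = s k"
proof -
  \<comment> \<open>The coefficient of degree \<open>j\<close> must be the symmetric function of
    index \<open>n - j\<close>, which \<open>s\<close> stores at \<open>n - 1 - j\<close>.\<close>
  define p where "p = Polynomial.monom 1 n + (\<Sum>j<n. Polynomial.monom (s (n - 1 - j)) j)"
  have coeff: "Polynomial.coeff p j = (if j = n then 1 else if j < n then s (n - 1 - j) else 0)" for j
    by (simp add: p_def Polynomial.coeff_sum)
  have deg: "Polynomial.degree p = n"
    by (rule order_antisym) (auto intro!: degree_le le_degree simp: coeff)
  have "p \<noteq> 0" using coeff[of n] by auto
  then obtain A where A: "size A = n" "p = (\<Prod>z\<in>#A. [:-z, 1:])"
    using alg_closed_imp_factorization[of p] deg coeff[of n] by auto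
  obtain zs where zs: "A = mset zs" by (metis ex_mset)
  define x where "x i = - zs ! i" for i
  have p: "p = (\<Prod>i<n. [:x i, 1:])"
    using A unfolding zs x_def
    by (simp add: prod_mset_prod_list prod.list_conv_set_nth atLeast0LessThan flip: mset_map)
  show thesis
  proof
    fix k assume "k < n"
    then show "elem_sym n (k + 1) x = s k"
      using vieta[of "k + 1" n x] coeff[of "n - (k + 1)"] by (simp flip: p)
  qed
qed

lemma mpeval_cong:
  assumes "vars_below n P" "\<And>i. i < n \<Longrightarrow> \<rho> i = \<sigma> i"
  shows "mpeval \<rho> P = mpeval \<sigma> P"
  unfolding mpeval_def using assms
  by (intro sum.cong arg_cong2[of _ _ _ _ "(*)"] prod.cong) (auto simp: vars_below_def subset_iff)

text \<open>By surjectivity of the elementary symmetric values, \<open>P\<close> and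
  \<open>Q\<close> agree at every complex point. This gives the uniqueness required by the
  \<open>THE\<close> in \<open>theta\<close>.\<close>

lemma elem_sym_alg_independent:
  assumes "vars_below n P" "vars_below n Q"
    and "\<And>x :: nat \<Rightarrow> complex. mpeval (\<lambda>i. elem_sym n (i + 1) x) P = mpeval (\<lambda>i. elem_sym n (i + 1) x) Q"
  shows "P = Q"
proof (rule mpoly_eqI_complex)
  fix s :: "nat \<Rightarrow> complex"
  obtain x where x: "\<And>k. k < n \<Longrightarrow> elem_sym n (k + 1) x = s k" using elem_sym_surj by blast
  show "mpeval s P = mpeval s Q"
    using mpeval_cong[OF assms(1) x] mpeval_cong[OF assms(2) x] assms(3)[of x] by simp
qed

text \<open>The passage from the complex numbers to any commutative ring. \<open>Theta\<close> is
  the function of the integer polynomial \<open>T\<close>, the product over the orbit of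
  \<open>P\<close>; its symmetric reduction \<open>R\<close> equals \<open>theta n m\<close>, and
  \<open>P\<close> is one of the factors of \<open>T\<close>.\<close>

lemma mpeval_dvd_theta:
  fixes \<rho> :: "nat \<Rightarrow> 'b::comm_ring_1"
  assumes vars: "vars_below n P" and P: "\<And>x. PsiY n m x = mpeval x P"
  shows "mpeval \<rho> P dvd mpeval (\<lambda>i. elem_sym n (i + 1) \<rho>) (theta n m)"
proof -
  define G where "G = {\<sigma>. \<sigma> permutes {..<n}}"
  \<comment> \<open>As a set, \<open>C\<close> contains each image once, which matches the product
    over distinct functions in \<open>Theta\<close>.\<close>
  define C where "C = (\<lambda>\<sigma>. mpeval (Var \<circ> \<sigma>) P) ` G"
  define T where "T = (\<Prod>Q\<in>C. Q)"
  have fin: "finite C" unfolding C_def G_def by (intro finite_imageI finite_permutations) simp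
  have comp: "mpeval \<xi> (mpeval (Var \<circ> \<sigma>) Q) = mpeval (\<xi> \<circ> \<sigma>) Q"
    for \<xi> :: "nat \<Rightarrow> 'c::comm_ring_1" and \<sigma> Q
    by (simp add: mpeval_mpeval o_def)
  have Theta: "Theta n m x = mpeval x T" for x
  proof -
    have "{(\<lambda>z. PsiY n m (z \<circ> \<sigma>)) | \<sigma>. \<sigma> permutes {..<n}} = (\<lambda>Q z. mpeval z Q) ` C"
      unfolding C_def G_def image_image comp P by auto
    moreover have "inj_on (\<lambda>Q (z :: nat \<Rightarrow> complex). mpeval z Q) C"
      by (intro inj_onI mpoly_eqI_complex) (metis fun_cong)
    ultimately show ?thesis
      by (simp add: Theta_def prod.reindex T_def mpeval_prod)
  qed
  have closed: "mpeval (Var \<circ> \<tau>) Q \<in> C" if "\<tau> \<in> G" "Q \<in> C" for \<tau> Q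
  proof -
    obtain \<sigma> where \<sigma>: "\<sigma> \<in> G" "Q = mpeval (Var \<circ> \<sigma>) P" using \<open>Q \<in> C\<close> by (auto simp: C_def)
    then have "mpeval (Var \<circ> \<tau>) Q = mpeval (Var \<circ> (\<tau> \<circ> \<sigma>)) P"
      by (simp add: comp o_assoc)
    then show ?thesis
      using \<sigma>(1) that(1) permutes_compose unfolding C_def G_def by blast
  qed
  have "symmetric_mpoly n T"
    unfolding symmetric_mpoly_def
  proof (intro allI impI)
    fix \<tau> assume \<tau>: "\<tau> permutes {..<n}"
    let ?\<iota> = "inv_into UNIV \<tau>"
    have inv: "\<tau> \<circ> ?\<iota> = id" "?\<iota> \<circ> \<tau> = id" "?\<iota> permutes {..<n}"
      using \<tau> by (auto simp: permutes_inv_o permutes_inv)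
    have G: "\<tau> \<in> G" "?\<iota> \<in> G" using \<tau> inv by (auto simp: G_def)
    have "(\<Prod>Q\<in>C. mpeval (Var \<circ> \<tau>) Q) = (\<Prod>Q\<in>C. Q)"
      by (rule prod.reindex_bij_witness[where i = "mpeval (Var \<circ> ?\<iota>)" and j = "mpeval (Var \<circ> \<tau>)"])
        (auto simp: comp comp_assoc inv intro: closed G)
    then show "mpeval (Var \<circ> \<tau>) T = T" by (simp add: T_def mpeval_prod)
  qed
  moreover have "vars_below n T"
    unfolding T_def
  proof (rule vars_below_prod)
    fix Q assume "Q \<in> C"
    then obtain \<sigma> where \<sigma>: "\<sigma> permutes {..<n}" "Q = mpeval (Var \<circ> \<sigma>) P" by (auto simp: C_def G_def)
    \<comment> \<open>Variables from \<open>n\<close> on are sent to 0 so that every value of the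
      substitution has its variables below \<open>n\<close>; on \<open>P\<close> the result is
      unchanged.\<close>
    define \<xi> where "\<xi> i = (if i < n then Var (\<sigma> i) else 0)" for i
    have "Q = mpeval \<xi> P"
      unfolding \<sigma>(2) by (rule mpeval_cong[OF vars]) (simp add: \<xi>_def)
    moreover have "vars_below n (\<xi> i)" for i
      using permutes_in_image[OF \<sigma>(1), of i] by (auto simp: \<xi>_def)
    ultimately show "vars_below n Q" using vars_below_mpeval by blast
  qed
  ultimately obtain R where R: "vars_below n R" "mpeval (\<lambda>i. elem_sym n (i + 1) Var) R = T"
    using symmetric_mpoly_reduction by blast
  \<comment> \<open>Evaluating an identity of integer polynomials makes it available in every
    commutative ring.\<close>
  have R_eval: "mpeval (\<lambda>i. elem_sym n (i + 1) \<xi>) R = mpeval \<xi> T" for \<xi> :: "nat \<Rightarrow> 'c::comm_ring_1"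
    by (simp add: mpeval_mpeval mpeval_elem_sym flip: R(2))
  have "theta n m = R"
    unfolding theta_def esym_eq_elem_sym Theta vars_below_def[symmetric]
  proof (rule the_equality)
    show "vars_below n R \<and> (\<forall>x :: nat \<Rightarrow> complex. mpeval (\<lambda>i. elem_sym n (i + 1) x) R = mpeval x T)"
      using R(1) R_eval by blast
    show "Q = R" if "vars_below n Q \<and> (\<forall>x :: nat \<Rightarrow> complex. mpeval (\<lambda>i. elem_sym n (i + 1) x) Q = mpeval x T)" for Q
    proof (rule elem_sym_alg_independent[of n])
      show "mpeval (\<lambda>i. elem_sym n (i + 1) x) Q = mpeval (\<lambda>i. elem_sym n (i + 1) x) R"
        for x :: "nat \<Rightarrow> complex"
        unfolding R_eval using that by blast
    qed (use that R(1) in auto)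
  qed
  then have "mpeval (\<lambda>i. elem_sym n (i + 1) \<rho>) (theta n m) = (\<Prod>Q\<in>C. mpeval \<rho> Q)"
    by (simp only: R_eval T_def mpeval_prod)
  moreover have "P \<in> C"
    unfolding C_def by (rule image_eqI[of _ _ id]) (auto simp: G_def permutes_id)
  ultimately show ?thesis using fin by (simp add: dvd_prodI)
qed

section \<open>The forms for degree six\<close>

text \<open>The quadratic relation reduces the sum to the shape \<open>u + c * v\<close>, ready for
  multiplication by the conjugate form.\<close>

lemma sum_powers_third:
  fixes c :: "'b::idom"
  assumes "c ^ 2 = - 1 - c"
  shows "(\<Sum>j<3. c ^ j * y j) = (y 0 - y 2) + c * (y 1 - y 2)"
  by (simp add: lessThan_nat_numeral lessThan_Suc assms algebra_simps)

lemma sum_powers_sixth: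
  fixes c :: "'b::idom"
  assumes "c ^ 2 = c - 1"
  shows "(\<Sum>j<6. c ^ j * y j) = (y 0 - y 2 - y 3 + y 5) + c * (y 1 + y 2 - y 4 - y 5)"
proof -
  have c: "c ^ 3 = -1" "c ^ 4 = - c" "c ^ 5 = 1 - c"
    using assms by Groebner_Basis.algebra+
  show ?thesis by (simp add: lessThan_nat_numeral lessThan_Suc assms c algebra_simps)
qed

lemma sum_powers_third_6:
  fixes c :: "'b::idom"
  assumes "c ^ 2 = - 1 - c"
  shows "(\<Sum>j<6. c ^ j * y j) = (y 0 + y 3 - (y 2 + y 5)) + c * (y 1 + y 4 - (y 2 + y 5))"
proof -
  have c: "c ^ 3 = 1" "c ^ 4 = c" "c ^ 5 = - 1 - c"
    using assms by Groebner_Basis.algebra+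
  show ?thesis by (simp add: lessThan_nat_numeral lessThan_Suc assms c algebra_simps)
qed

text \<open>\<open>c\<close> and \<open>c ^ 2\<close> are the conjugate roots of
  \<open>X^2 + X + 1\<close>; the product of the conjugate linear forms is a norm form with integer
  coefficients.\<close>

lemma third_root_conj:
  fixes c u v :: "'b::idom"
  assumes "c ^ 2 = - 1 - c"
  shows "(c ^ 2) ^ 2 = - 1 - c ^ 2"
    and "(u + c * v) * (u + c ^ 2 * v) = u ^ 2 - u * v + v ^ 2"
  using assms by Groebner_Basis.algebra+

text \<open>The analogue for \<open>X^2 - X + 1\<close>, where the conjugate of \<open>c\<close> is
  \<open>c ^ 5 = 1 - c\<close>.\<close>

lemma sixth_root_conj:
  fixes c u v :: "'b::idom"
  assumes "c ^ 2 = c - 1"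
  shows "(c ^ 5) ^ 2 = c ^ 5 - 1"
    and "(u + c * v) * (u + c ^ 5 * v) = u ^ 2 + u * v + v ^ 2"
  using assms by Groebner_Basis.algebra+

lemma PsiY_6_2: "PsiY 6 2 x = x 0 - x 1 + x 2 - x 3 + x 4 - x 5"
proof -
  have "{i \<in> {..<2::nat}. coprime i 2} = {1}"
    by (auto simp: lessThan_nat_numeral lessThan_Suc)
  then show ?thesis
    by (simp add: PsiY_def Psi_def Yv_def lessThan_nat_numeral lessThan_Suc)
      (simp add: numeral_eq_Suc)
qed

text \<open>Multiplying the conjugate factors for the units 1 and 2 modulo 3 eliminates the complex
  root \<open>w\<close>, leaving an integer form as \<open>mpeval_dvd_theta\<close>
  requires.\<close>

lemma PsiY_6_3: "PsiY 6 3 x = (let u = x 0 + x 3 - (x 2 + x 5); v = x 1 + x 4 - (x 2 + x 5)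
    in u ^ 2 - u * v + v ^ 2)"
proof -
  define w where "w = cis (2 * pi / 3)"
  have w: "w ^ 2 = - 1 - w"
    by (auto simp: w_def complex_eq_iff power2_eq_square cos_120 sin_120 cos_120' sin_120')
  have two: "{..<2::nat} = {0, 1}" by auto
  have units: "{i \<in> {..<3::nat}. coprime i 3} = {1, 2}"
    by (auto simp: lessThan_nat_numeral lessThan_Suc)
  have "PsiY 6 3 x = (\<Sum>j<3. w ^ j * Yv 6 3 x j) * (\<Sum>j<3. (w ^ 2) ^ j * Yv 6 3 x j)"
    unfolding PsiY_def Psi_def units by (simp add: w_def flip: power_mult)
  also have "\<dots> = (Yv 6 3 x 0 - Yv 6 3 x 2 + w * (Yv 6 3 x 1 - Yv 6 3 x 2)) *
      (Yv 6 3 x 0 - Yv 6 3 x 2 + w ^ 2 * (Yv 6 3 x 1 - Yv 6 3 x 2))"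
    unfolding sum_powers_third[OF w] sum_powers_third[OF third_root_conj(1)[OF w]] ..
  also have "\<dots> = (let u = Yv 6 3 x 0 - Yv 6 3 x 2; v = Yv 6 3 x 1 - Yv 6 3 x 2
      in u ^ 2 - u * v + v ^ 2)"
    unfolding Let_def by (rule third_root_conj(2)[OF w])
  finally show ?thesis
    by (simp add: Yv_def two numeral_2_eq_2)
qed

lemma PsiY_6_6: "PsiY 6 6 x = (let u = x 0 - x 2 - x 3 + x 5; v = x 1 + x 2 - x 4 - x 5
    in u ^ 2 + u * v + v ^ 2)"
proof -
  define w where "w = cis (2 * pi / 6)"
  have w: "w ^ 2 = w - 1"
    by (auto simp: w_def complex_eq_iff power2_eq_square cos_60 sin_60)
  have units: "{i \<in> {..<6::nat}. coprime i 6} = {1, 5}"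
    by code_simp
  have "PsiY 6 6 x = (\<Sum>j<6. w ^ j * x j) * (\<Sum>j<6. (w ^ 5) ^ j * x j)"
    unfolding PsiY_def Psi_def units by (simp add: w_def Yv_def flip: power_mult)
  also have "\<dots> = (x 0 - x 2 - x 3 + x 5 + w * (x 1 + x 2 - x 4 - x 5)) *
      (x 0 - x 2 - x 3 + x 5 + w ^ 5 * (x 1 + x 2 - x 4 - x 5))"
    unfolding sum_powers_sixth[OF w] sum_powers_sixth[OF sixth_root_conj(1)[OF w]] ..
  also have "\<dots> = (let u = x 0 - x 2 - x 3 + x 5; v = x 1 + x 2 - x 4 - x 5
      in u ^ 2 + u * v + v ^ 2)"
    unfolding Let_def by (rule sixth_root_conj(2)[OF w])
  finally show ?thesis .
qed

lemmas vars_below_intros = vars_below_add vars_below_diff vars_below_mult vars_below_power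

lemma alternating_sum_dvd_theta_6_2:
  fixes \<rho> :: "nat \<Rightarrow> 'b::idom"
  shows "(\<Sum>j<6. (-1) ^ j * \<rho> j) dvd mpeval (\<lambda>i. elem_sym 6 (i + 1) \<rho>) (theta 6 2)"
proof -
  define P where "P = Var 0 - Var 1 + Var 2 - Var 3 + Var 4 - Var 5"
  have "vars_below 6 P" by (auto simp: P_def intro!: vars_below_intros)
  then have "mpeval \<rho> P dvd mpeval (\<lambda>i. elem_sym 6 (i + 1) \<rho>) (theta 6 2)"
    by (rule mpeval_dvd_theta) (simp add: PsiY_6_2 P_def)
  moreover have "(\<Sum>j<6. (-1) ^ j * \<rho> j) = mpeval \<rho> P"
    by (simp add: P_def lessThan_nat_numeral lessThan_Suc algebra_simps)
  ultimately show ?thesis by simp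
qed

text \<open>Over any integral domain containing such a \<open>c\<close>, the norm form splits into
  two linear factors, one of which is the given sum.\<close>

lemma cubic_sum_dvd_theta_6_3:
  fixes \<rho> :: "nat \<Rightarrow> 'b::idom"
  assumes c: "c ^ 2 = - 1 - c"
  shows "(\<Sum>j<6. c ^ j * \<rho> j) dvd mpeval (\<lambda>i. elem_sym 6 (i + 1) \<rho>) (theta 6 3)"
proof -
  define U V where "U = Var 0 + Var 3 - (Var 2 + Var 5)" "V = Var 1 + Var 4 - (Var 2 + Var 5)"
  define P where "P = U ^ 2 - U * V + V ^ 2"
  have "vars_below 6 P" by (auto simp: P_def U_V_def intro!: vars_below_intros)
  then have "mpeval \<rho> P dvd mpeval (\<lambda>i. elem_sym 6 (i + 1) \<rho>) (theta 6 3)"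
    by (rule mpeval_dvd_theta) (simp add: PsiY_6_3 P_def U_V_def Let_def)
  moreover have "mpeval \<rho> P = (mpeval \<rho> U + c * mpeval \<rho> V) * (mpeval \<rho> U + c ^ 2 * mpeval \<rho> V)"
    unfolding P_def third_root_conj(2)[OF c] by simp
  moreover have "(\<Sum>j<6. c ^ j * \<rho> j) = mpeval \<rho> U + c * mpeval \<rho> V"
    by (simp add: sum_powers_third_6[OF c] U_V_def)
  ultimately show ?thesis by (metis dvd_mult_left)
qed

lemma sextic_sum_dvd_theta_6_6:
  fixes \<rho> :: "nat \<Rightarrow> 'b::idom"
  assumes c: "c ^ 2 = c - 1"
  shows "(\<Sum>j<6. c ^ j * \<rho> j) dvd mpeval (\<lambda>i. elem_sym 6 (i + 1) \<rho>) (theta 6 6)"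
proof -
  define U V where "U = Var 0 - Var 2 - Var 3 + Var 5" "V = Var 1 + Var 2 - Var 4 - Var 5"
  define P where "P = U ^ 2 + U * V + V ^ 2"
  have "vars_below 6 P" by (auto simp: P_def U_V_def intro!: vars_below_intros)
  then have "mpeval \<rho> P dvd mpeval (\<lambda>i. elem_sym 6 (i + 1) \<rho>) (theta 6 6)"
    by (rule mpeval_dvd_theta) (simp add: PsiY_6_6 P_def U_V_def Let_def)
  moreover have "mpeval \<rho> P = (mpeval \<rho> U + c * mpeval \<rho> V) * (mpeval \<rho> U + c ^ 5 * mpeval \<rho> V)"
    unfolding P_def sixth_root_conj(2)[OF c] by simp
  moreover have "(\<Sum>j<6. c ^ j * \<rho> j) = mpeval \<rho> U + c * mpeval \<rho> V"
    by (simp add: sum_powers_sixth[OF c] U_V_def)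
  ultimately show ?thesis by (metis dvd_mult_left)
qed

section \<open>Frobenius orbits over a finite field\<close>

text \<open>Multiplication by a nonzero \<open>x\<close> permutes the nonzero elements, so their
  product absorbs the factor \<open>x ^ (CARD('a) - 1)\<close>.\<close>

lemma finite_field_power_card:
  fixes x :: "'a::{finite,field}"
  shows "x ^ CARD('a) = x"
proof (cases "x = 0")
  case False
  define w where "w = (\<Prod>y\<in>UNIV - {0::'a}. y)"
  have "(\<Prod>y\<in>UNIV - {0::'a}. x * y) = w"
    unfolding w_def
    by (rule prod.reindex_bij_witness[where i = "\<lambda>y. y / x" and j = "\<lambda>y. x * y"]) (use False in auto)
  then have "x ^ (CARD('a) - 1) * w = w"
    by (simp add: prod.distrib w_def card_Diff_subset)
  moreover have "w \<noteq> 0" by (simp add: w_def)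
  ultimately have "x ^ (CARD('a) - 1) = 1" by simp
  then have "x * x ^ (CARD('a) - 1) = x" by simp
  then show ?thesis by (simp flip: power_Suc)
qed auto

text \<open>The difference of the two sides, as a polynomial in \<open>y\<close>, has degree below
  \<open>q\<close> but vanishes on the \<open>q\<close> elements of the base field.\<close>

lemma frobenius_add_if_on_base:
  fixes x y :: "'a::{finite,field} alg_closure"
  assumes base: "\<And>c :: 'a. (x + to_ac c) ^ CARD('a) = x ^ CARD('a) + to_ac c"
  shows "(x + y) ^ CARD('a) = x ^ CARD('a) + y ^ CARD('a)"
proof -
  define q where "q = CARD('a)"
  define p where "p = [:x, 1:] ^ q - Polynomial.monom 1 q - [:x ^ q:]"
  have "q > 0" by (simp add: q_def)
  have eval: "poly p t = (x + t) ^ q - t ^ q - x ^ q" for t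
    by (simp add: p_def poly_monom)
  have "p = 0"
  proof (rule ccontr)
    assume "p \<noteq> 0"
    have "Polynomial.degree p \<le> q"
      unfolding p_def by (intro degree_diff_le) (auto simp: degree_linear_power degree_monom_eq)
    \<comment> \<open>The leading term of \<open>[:x, 1:] ^ q\<close> is cancelled by the subtracted
      monomial.\<close>
    moreover have "Polynomial.coeff p q = 0"
      using \<open>q > 0\<close> by (auto simp: p_def coeff_linear_power coeff_pCons split: nat.split)
    ultimately have "Polynomial.degree p < q"
      using \<open>p \<noteq> 0\<close> by (metis leading_coeff_0_iff order_le_less)
    moreover have "card (range (to_ac :: 'a \<Rightarrow> _)) \<le> card {t. poly p t = 0}"
    proof (rule card_mono)
      show "finite {t. poly p t = 0}" using \<open>p \<noteq> 0\<close> by (rule poly_roots_finite)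
      have "to_ac c ^ q = to_ac c" for c :: 'a
        unfolding q_def by (simp add: finite_field_power_card flip: to_ac_power)
      then show "range (to_ac :: 'a \<Rightarrow> _) \<subseteq> {t. poly p t = 0}"
        using base unfolding eval q_def by auto
    qed
    moreover have "card (range (to_ac :: 'a \<Rightarrow> _)) = q"
      by (simp add: card_image inj_to_ac q_def)
    moreover have "card {t. poly p t = 0} \<le> Polynomial.degree p"
      using \<open>p \<noteq> 0\<close> by (rule card_poly_roots_bound)
    ultimately show False by simp
  qed
  then show ?thesis using eval[of y] by (simp add: q_def diff_eq_eq)
qed

text \<open>The criterion is applied twice: first with \<open>x\<close> in the base field, where the
  power map is the identity, and then for general \<open>x\<close>.\<close>

lemma frobenius_add:
  fixes x y :: "'a::{finite,field} alg_closure"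
  shows "(x + y) ^ CARD('a) = x ^ CARD('a) + y ^ CARD('a)"
proof (rule frobenius_add_if_on_base)
  fix c :: 'a
  have "(to_ac c + x) ^ CARD('a) = to_ac c ^ CARD('a) + x ^ CARD('a)"
    by (rule frobenius_add_if_on_base) (simp add: finite_field_power_card flip: to_ac_power to_ac_add)
  then show "(x + to_ac c) ^ CARD('a) = x ^ CARD('a) + to_ac c"
    by (simp add: add.commute finite_field_power_card flip: to_ac_power)
qed

lemma frobenius_uminus:
  fixes x :: "'a::{finite,field} alg_closure"
  shows "(- x) ^ CARD('a) = - (x ^ CARD('a))"
  using frobenius_add[of x "- x"] by (simp add: power_0_left eq_neg_iff_add_eq_0 add.commute)

lemma frobenius_sum:
  fixes f :: "'b \<Rightarrow> 'a::{finite,field} alg_closure"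
  shows "(\<Sum>i\<in>A. f i) ^ CARD('a) = (\<Sum>i\<in>A. f i ^ CARD('a))"
  by (induction A rule: infinite_finite_induct) (auto simp: frobenius_add power_0_left)

lemma frobenius_inject:
  fixes x y :: "'a::{finite,field} alg_closure"
  shows "x ^ CARD('a) = y ^ CARD('a) \<longleftrightarrow> x = y"
proof
  assume "x ^ CARD('a) = y ^ CARD('a)"
  then have "(x + - y) ^ CARD('a) = 0" by (simp only: frobenius_add frobenius_uminus) simp
  then show "x = y" by simp
qed simp

text \<open>The polynomial \<open>X^q - X\<close> has at most \<open>q\<close> roots, and the base
  field already supplies \<open>q\<close> of them.\<close>

lemma frobenius_fixed_iff:
  fixes x :: "'a::{finite,field} alg_closure"
  shows "x ^ CARD('a) = x \<longleftrightarrow> x \<in> range to_ac"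
proof -
  define q where "q = CARD('a)"
  define p :: "'a alg_closure poly" where "p = Polynomial.monom 1 q - [:0, 1:]"
  have "card {0, 1 :: 'a} \<le> q" unfolding q_def by (rule card_mono) auto
  then have q: "q > 1" by simp
  have "Polynomial.coeff p q = 1" using q by (auto simp: p_def coeff_pCons split: nat.split)
  then have "p \<noteq> 0" by auto
  have "Polynomial.degree p \<le> q"
    unfolding p_def using q by (intro degree_diff_le) (auto simp: degree_monom_eq)
  then have "card {t. poly p t = 0} \<le> q"
    using card_poly_roots_bound[OF \<open>p \<noteq> 0\<close>] by simp
  moreover have sub: "range (to_ac :: 'a \<Rightarrow> _) \<subseteq> {t. poly p t = 0}"
    by (auto simp: p_def poly_monom q_def finite_field_power_card simp flip: to_ac_power)
  moreover have "card (range (to_ac :: 'a \<Rightarrow> _)) = q"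
    by (simp add: card_image inj_to_ac q_def)
  ultimately have "range (to_ac :: 'a \<Rightarrow> _) = {t. poly p t = 0}"
    using card_seteq[OF poly_roots_finite[OF \<open>p \<noteq> 0\<close>] sub] by simp
  then show ?thesis by (auto simp: p_def poly_monom q_def)
qed

section \<open>Frobenius acting on polynomials and on roots\<close>

lemma map_poly_mult_hom:
  assumes h: "h 0 = 0" "\<And>a b. h (a + b) = h a + h b" "\<And>a b. h (a * b) = h a * h b"
  shows "map_poly h (p * q) = map_poly h p * map_poly h q"
proof -
  have "h (\<Sum>i\<in>A. f i) = (\<Sum>i\<in>A. h (f i))" for A :: "nat set" and f
    by (induction A rule: infinite_finite_induct) (auto simp: h)
  then show ?thesis
    by (intro poly_eqI) (simp add: coeff_map_poly coeff_mult h)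
qed

lemma frobenius_map_poly_prod:
  fixes A :: "'a::{finite,field} alg_closure set"
  shows "map_poly (\<lambda>x. x ^ CARD('a)) (\<Prod>z\<in>A. [:- z, 1:]) = (\<Prod>z\<in>A. [:- (z ^ CARD('a)), 1:])"
proof (induction A rule: infinite_finite_induct)
  case (insert z A)
  have "map_poly (\<lambda>x. x ^ CARD('a)) ([:- z, 1:] * (\<Prod>z\<in>A. [:- z, 1:])) =
      map_poly (\<lambda>x. x ^ CARD('a)) [:- z, 1:] * map_poly (\<lambda>x. x ^ CARD('a)) (\<Prod>z\<in>A. [:- z, 1:])"
    by (rule map_poly_mult_hom) (auto simp: frobenius_add power_mult_distrib power_0_left)
  then show ?case using insert
    by (simp add: map_poly_pCons power_0_left frobenius_uminus)
qed (simp_all add: map_poly_1)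

text \<open>Division with remainder shows that an annihilating polynomial \<open>h\<close> of least
  degree divides \<open>f\<close>; being nonconstant, it has the same degree as the irreducible
  \<open>f\<close>.\<close>

lemma irreducible_degree_le_annihilator:
  fixes f g :: "'a::field poly"
  assumes f: "Factorial_Ring.irreducible f" "poly (map_poly to_ac f) r = 0"
    and g: "g \<noteq> 0" "poly (map_poly to_ac g) r = 0"
  shows "Polynomial.degree f \<le> Polynomial.degree g"
proof -
  define ann where "ann h \<longleftrightarrow> h \<noteq> 0 \<and> poly (map_poly to_ac h) r = 0" for h
  obtain h where h: "ann h" "\<And>h'. ann h' \<Longrightarrow> Polynomial.degree h \<le> Polynomial.degree h'"
    using ex_has_least_nat[of ann g Polynomial.degree] g by (auto simp: ann_def)
  have poly_map: "poly (map_poly to_ac (s * t + u)) r =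
      poly (map_poly to_ac s) r * poly (map_poly to_ac t) r + poly (map_poly to_ac u) r"
    for s t u :: "'a poly"
  proof -
    have "map_poly to_ac (s * t + u) = map_poly to_ac (s * t) + map_poly to_ac u"
      by (intro poly_eqI) (simp add: coeff_map_poly)
    also have "map_poly to_ac (s * t) = map_poly to_ac s * map_poly to_ac t"
      by (rule map_poly_mult_hom) auto
    finally show ?thesis by simp
  qed
  have "h \<noteq> 0" using h by (simp add: ann_def)
  have "f mod h = 0"
  proof (rule ccontr)
    assume nz: "f mod h \<noteq> 0"
    have "poly (map_poly to_ac (f mod h)) r = 0"
      using poly_map[of "f div h" h "f mod h"] f h by (simp add: ann_def)
    then have "Polynomial.degree h \<le> Polynomial.degree (f mod h)" using nz h(2) by (simp add: ann_def)
    then show False using degree_mod_less[OF \<open>h \<noteq> 0\<close>, of f] nz by simp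
  qed
  then have fh: "f = h * (f div h)" by (metis dvd_eq_mod_eq_0 dvd_mult_div_cancel)
  have "\<not> h dvd 1"
  proof
    assume "h dvd 1"
    then obtain c where "h = [:c:]" "c \<noteq> 0"
      by (metis is_unit_polyE dvd_0_left_iff zero_neq_one)
    then show False using h(1) by (simp add: ann_def map_poly_pCons)
  qed
  then have "f div h dvd 1" using Factorial_Ring.irreducibleD[OF f(1) fh] by blast
  then have "Polynomial.degree (f div h) = 0" by (metis is_unit_iff_degree not_is_unit_0)
  moreover have "f div h \<noteq> 0" using \<open>f div h dvd 1\<close> by auto
  ultimately have "Polynomial.degree f = Polynomial.degree h"
    using \<open>h \<noteq> 0\<close> fh by (metis add.right_neutral degree_mult_eq)
  then show ?thesis using h(2)[of g] g by (simp add: ann_def)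
qed

text \<open>Frobenius permutes the orbit \<open>O'\<close> of \<open>r\<close>, so the monic
  polynomial \<open>g\<close> with simple roots \<open>O'\<close> has coefficients in the base
  field. Hence \<open>O'\<close> has at least \<open>n\<close> elements, while \<open>f\<close> has
  at most \<open>n\<close> roots.\<close>

lemma frobenius_orbit_of_root:
  fixes f :: "'a::{finite,field} poly"
  assumes irred: "Factorial_Ring.irreducible f" and root: "poly (map_poly to_ac f) r = 0"
  defines "n \<equiv> Polynomial.degree f" and "\<rho> \<equiv> \<lambda>i. r ^ (CARD('a) ^ i)"
  shows "bij_betw \<rho> {..<n} {z. poly (map_poly to_ac f) z = 0}" and "\<rho> (i + n) = \<rho> i"
proof -
  let ?R = "{z. poly (map_poly to_ac f) z = 0}"
  have "f \<noteq> 0" using irred by (simp add: Factorial_Ring.irreducible_def)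
  then have m0: "map_poly to_ac f \<noteq> 0" by (simp add: map_poly_eq_0_iff)
  have finR: "finite ?R" using m0 by (rule poly_roots_finite)
  have cardR: "card ?R \<le> n"
    using card_poly_roots_bound[OF m0] by (simp add: n_def degree_map_poly)
  have \<rho>_Suc: "\<rho> (Suc i) = \<rho> i ^ CARD('a)" for i
    by (simp add: \<rho>_def mult.commute flip: power_mult)
  have frob_root: "z ^ CARD('a) \<in> ?R" if "z \<in> ?R" for z
  proof -
    have "0 = poly (map_poly to_ac f) z ^ CARD('a)" using that by (simp add: power_0_left)
    also have "\<dots> = poly (map_poly to_ac f) (z ^ CARD('a))"
    proof -
      have "to_ac c ^ CARD('a) = to_ac c" for c :: 'a
        by (simp add: frobenius_fixed_iff)
      then show ?thesis
        by (simp add: poly_altdef frobenius_sum power_mult_distrib coeff_map_poly degree_map_poly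
            power_commutes flip: power_mult) (simp add: mult.commute)
    qed
    finally show ?thesis by simp
  qed
  have in_R: "\<rho> i \<in> ?R" for i
  proof (induction i)
    case 0
    then show ?case using root by (simp add: \<rho>_def)
  next
    case (Suc i)
    show ?case unfolding \<rho>_Suc by (rule frob_root) (rule Suc)
  qed
  define O' where "O' = range \<rho>"
  have sub: "O' \<subseteq> ?R" using in_R by (auto simp: O'_def)
  have finO: "finite O'" using finite_subset[OF sub finR] .
  have inj_frob: "inj_on (\<lambda>z. z ^ CARD('a)) O'" by (auto simp: inj_on_def frobenius_inject)
  have "(\<lambda>z. z ^ CARD('a)) ` O' \<subseteq> O'" by (auto simp: O'_def simp flip: \<rho>_Suc)
  then have surj_frob: "(\<lambda>z. z ^ CARD('a)) ` O' = O'"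
    using endo_inj_surj[OF finO _ inj_frob] by blast
  define g where "g = (\<Prod>z\<in>O'. [:- z, 1:])"
  have deg_g: "Polynomial.degree g = card O'"
    unfolding g_def by (subst degree_prod_sum_eq) auto
  have "map_poly (\<lambda>x. x ^ CARD('a)) g = (\<Prod>z\<in>(\<lambda>z. z ^ CARD('a)) ` O'. [:- z, 1:])"
    unfolding g_def frobenius_map_poly_prod prod.reindex[OF inj_frob] by simp
  then have "map_poly (\<lambda>x. x ^ CARD('a)) g = g" by (simp add: surj_frob g_def)
  then have "Polynomial.coeff g i ^ CARD('a) = Polynomial.coeff g i" for i
    by (metis coeff_map_poly power_0_left zero_less_card_finite less_numeral_extra(3))
  then have coeff_g: "to_ac (of_ac (Polynomial.coeff g i) :: 'a) = Polynomial.coeff g i" for i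
    by (simp add: frobenius_fixed_iff to_ac_of_ac)
  define g0 :: "'a poly" where "g0 = map_poly of_ac g"
  have g0: "map_poly to_ac g0 = g"
    by (rule poly_eqI) (simp add: g0_def coeff_map_poly coeff_g)
  have "g \<noteq> 0" using finO by (simp add: g_def)
  have "r \<in> O'" unfolding O'_def by (rule range_eqI[of _ _ 0]) (simp add: \<rho>_def)
  then have "poly g r = 0" using finO by (auto simp: g_def poly_prod)
  then have "n \<le> Polynomial.degree g0"
    unfolding n_def using g0 \<open>g \<noteq> 0\<close>
    by (intro irreducible_degree_le_annihilator[OF irred root]) auto
  also have "Polynomial.degree g0 = card O'"
    unfolding deg_g[symmetric] g0[symmetric] by (simp add: degree_map_poly)
  finally have le: "n \<le> card O'" .
  then have R: "?R = O'" and card_O: "card O' = n"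
    using card_seteq[OF finR sub] cardR card_mono[OF finR sub] by auto
  have shift: "\<rho> (i + k) = \<rho> (j + k)" if "\<rho> i = \<rho> j" for i j k
    using that by (induction k) (simp_all add: \<rho>_Suc)
  have inj: "inj_on \<rho> {..<n}"
  proof (rule linorder_inj_onI)
    fix i j assume ij: "i < j" "j \<in> {..<n}"
    show "\<rho> i \<noteq> \<rho> j"
    proof
      \<comment> \<open>A coincidence would confine the whole orbit to its first
        \<open>j < n\<close> members.\<close>
      assume eq: "\<rho> i = \<rho> j"
      have "\<rho> k \<in> \<rho> ` {..<j}" for k
      proof (induction k rule: less_induct)
        case (less k)
        show ?case
        proof (cases "k < j")
          case False
          then have "\<rho> k = \<rho> (i + (k - j))" using shift[OF eq, of "k - j"] by simp
          also have "\<dots> \<in> \<rho> ` {..<j}" using False ij by (intro less) simp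
          finally show ?thesis .
        qed auto
      qed
      then have "O' \<subseteq> \<rho> ` {..<j}" by (auto simp: O'_def)
      then have "card O' \<le> j"
        using card_mono[of "\<rho> ` {..<j}" O'] card_image_le[of "{..<j}" \<rho>] by simp
      then show False using card_O ij by simp
    qed
  qed auto
  have "\<rho> ` {..<n} = O'"
    by (rule card_subset_eq[OF finO]) (auto simp: O'_def card_image[OF inj] card_O[unfolded O'_def])
  then show "bij_betw \<rho> {..<n} ?R" using inj R by (simp add: bij_betw_def)
  have "\<rho> n \<in> \<rho> ` {..<n}" unfolding \<open>\<rho> ` {..<n} = O'\<close> by (simp add: O'_def)
  then obtain k where k: "k < n" "\<rho> n = \<rho> k" by auto
  \<comment> \<open>If \<open>k\<close> were positive, injectivity of Frobenius would move the
    coincidence back to \<open>n - 1\<close> and \<open>k - 1\<close>, against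
    \<open>inj\<close>.\<close>
  have "k = 0"
  proof (rule ccontr)
    assume "k \<noteq> 0"
    then obtain k' where k': "k = Suc k'" by (cases k) auto
    obtain n' where n': "n = Suc n'" using k by (cases n) auto
    have "\<rho> n' = \<rho> k'" using k(2) unfolding k' n' \<rho>_Suc frobenius_inject .
    then have "n' = k'" using inj k(1) unfolding k' n' by (auto dest: inj_onD)
    then show False using k(1) unfolding k' n' by simp
  qed
  then show "\<rho> (i + n) = \<rho> i" using shift[of n 0 i] k by (simp add: add.commute)
qed

section \<open>Cyclic convolutions and normality\<close>

text \<open>Moving the window by one step drops \<open>f i\<close> and appends the equal value
  \<open>f (i + n)\<close>.\<close>

lemma sum_periodic_shift:
  fixes f :: "nat \<Rightarrow> 'b::ab_group_add"
  assumes "\<And>i. f (i + n) = f i"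
  shows "(\<Sum>k<n. f (i + k)) = (\<Sum>k<n. f k)"
proof (induction i)
  case (Suc i)
  have "f i + (\<Sum>k<n. f (Suc i + k)) = (\<Sum>k<Suc n. f (i + k))"
    unfolding sum.lessThan_Suc_shift by simp
  also have "\<dots> = (\<Sum>k<n. f (i + k)) + f i" using assms by simp
  finally show ?case using Suc by (simp add: add.commute)
qed simp

text \<open>The discrete Fourier transform turns the cyclic convolution of \<open>b\<close> and \<open>x\<close> into a product.\<close>

lemma fourier_coeff_eq_0:
  fixes b x :: "nat \<Rightarrow> 'k::field"
  assumes d: "d ^ n = 1" and "n > 0"
    and conv: "\<And>k. (\<Sum>i<n. b i * x (i + k)) = 0"
    and periodic: "\<And>i. x (i + n) = x i"
    and nz: "\<And>c. c ^ n = 1 \<Longrightarrow> (\<Sum>j<n. c ^ j * x j) \<noteq> 0"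
  shows "(\<Sum>i<n. d ^ i * b i) = 0"
proof -
  \<comment> \<open>The index \<open>i + k\<close> makes \<open>conv\<close> a correlation, so the
    transform of \<open>b\<close> at \<open>d\<close> pairs with that of \<open>x\<close> at the
    inverse root.\<close>
  define c where "c = inverse d"
  have "d \<noteq> 0" using d \<open>n > 0\<close> by (auto simp: power_0_left)
  then have cd: "d * c = 1" "c ^ n = 1" by (simp_all add: c_def power_inverse d)
  define S where "S = (\<Sum>j<n. c ^ j * x j)"
  have shift: "(\<Sum>k<n. c ^ k * x (i + k)) = d ^ i * S" for i
  proof -
    have "S = (\<Sum>k<n. c ^ (i + k) * x (i + k))"
      unfolding S_def by (rule sum_periodic_shift[symmetric]) (simp add: power_add cd periodic)
    also have "\<dots> = c ^ i * (\<Sum>k<n. c ^ k * x (i + k))"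
      by (simp add: sum_distrib_left power_add mult.assoc)
    finally show ?thesis using cd by (simp flip: mult.assoc power_mult_distrib)
  qed
  have "0 = (\<Sum>k<n. c ^ k * (\<Sum>i<n. b i * x (i + k)))" by (simp add: conv)
  also have "\<dots> = (\<Sum>i<n. b i * (\<Sum>k<n. c ^ k * x (i + k)))"
    unfolding sum_distrib_left by (subst sum.swap) (simp add: mult_ac)
  also have "\<dots> = (\<Sum>i<n. d ^ i * b i) * S"
    unfolding shift sum_distrib_right by (simp add: mult_ac)
  finally show ?thesis using nz[OF cd(2)] by (simp add: S_def)
qed

text \<open>Subtracting the equations leaves \<open>(s - t) * v = 0\<close>, and the square of
  \<open>2 * z - 1\<close> is \<open>-3\<close>. The conjugate pairs \<open>z, z ^ 5\<close> and
  \<open>z ^ 2, z ^ 4\<close> both have this difference.\<close>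

lemma sixth_root_cancel:
  fixes z u v :: "'b::idom"
  assumes z: "z ^ 2 = z - 1" and "u + s * v = 0" "u + t * v = 0" "s - t = 2 * z - 1"
    and "(3 :: 'b) \<noteq> 0"
  shows "v = 0"
proof -
  have "(s - t) * v = 0" using assms(2,3) by Groebner_Basis.algebra
  then have "(2 * z - 1) * ((2 * z - 1) * v) = 0" by (simp add: assms(4))
  moreover have "(2 * z - 1) * ((2 * z - 1) * v) = - 3 * v" using z by Groebner_Basis.algebra
  ultimately show ?thesis using \<open>3 \<noteq> 0\<close> by simp
qed

text \<open>All Fourier coefficients of \<open>b\<close> at the sixth roots of unity vanish; Fourier
  inversion, written out for length 6, then divides by 6.\<close>

lemma cyclic_convolution_6_injective:
  fixes b x :: "nat \<Rightarrow> 'k::alg_closed_field"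
  assumes conv: "\<And>k. (\<Sum>i<6. b i * x (i + k)) = 0"
    and periodic: "\<And>i. x (i + 6) = x i"
    and nz: "\<And>c. c ^ 6 = 1 \<Longrightarrow> (\<Sum>j<6. c ^ j * x j) \<noteq> 0"
    and char: "(6 :: 'k) \<noteq> 0" and "i < 6"
  shows "b i = 0"
proof -
  have B: "(\<Sum>i<6. d ^ i * b i) = 0" if "d ^ 6 = 1" for d
    using that by (rule fourier_coeff_eq_0[OF _ _ conv periodic nz]) auto
  \<comment> \<open>The polynomial is the sixth cyclotomic one; the powers of its root
    \<open>z\<close> supply the sixth roots of unity.\<close>
  have "\<exists>z :: 'k. poly [:1, -1, 1:] z = 0" by (rule alg_closed_imp_poly_has_root) simp
  then obtain z :: 'k where "1 + z * (z - 1) = 0" by auto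
  then have z: "z ^ 2 = z - 1" by Groebner_Basis.algebra
  have z2: "(z ^ 2) ^ 2 = - 1 - z ^ 2" and z4: "(z ^ 4) ^ 2 = - 1 - z ^ 4" and z4': "z ^ 4 = - z"
    and z5: "z ^ 5 = 1 - z"
    using z by Groebner_Basis.algebra+
  have roots: "z ^ 6 = 1" "(z ^ 5) ^ 6 = 1" "(z ^ 2) ^ 6 = 1" "(z ^ 4) ^ 6 = 1"
    using z by Groebner_Basis.algebra+
  have e0: "b 0 + b 1 + b 2 + b 3 + b 4 + b 5 = 0"
    using B[of 1] by (simp add: lessThan_nat_numeral lessThan_Suc algebra_simps)
  have e3: "b 0 - b 1 + b 2 - b 3 + b 4 - b 5 = 0"
    using B[of "-1"] by (simp add: lessThan_nat_numeral lessThan_Suc algebra_simps)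
  have e1: "(b 0 - b 2 - b 3 + b 5) + z * (b 1 + b 2 - b 4 - b 5) = 0"
    using B[OF roots(1)] unfolding sum_powers_sixth[OF z] .
  have e5: "(b 0 - b 2 - b 3 + b 5) + z ^ 5 * (b 1 + b 2 - b 4 - b 5) = 0"
    using B[OF roots(2)] unfolding sum_powers_sixth[OF sixth_root_conj(1)[OF z]] .
  have e2: "(b 0 + b 3 - (b 2 + b 5)) + z ^ 2 * (b 1 + b 4 - (b 2 + b 5)) = 0"
    using B[OF roots(3)] unfolding sum_powers_third_6[OF z2] .
  have e4: "(b 0 + b 3 - (b 2 + b 5)) + z ^ 4 * (b 1 + b 4 - (b 2 + b 5)) = 0"
    using B[OF roots(4)] unfolding sum_powers_third_6[OF z4] .
  have three: "(3 :: 'k) \<noteq> 0"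
  proof
    assume "(3 :: 'k) = 0"
    then have "2 * 3 = (0 :: 'k)" by simp
    then show False using char by simp
  qed
  have V1: "b 1 + b 2 - b 4 - b 5 = 0"
    by (rule sixth_root_cancel[OF z e1 e5 _ three]) (simp add: z5)
  then have U1: "b 0 - b 2 - b 3 + b 5 = 0" using e1 by simp
  have V2: "b 1 + b 4 - (b 2 + b 5) = 0"
    by (rule sixth_root_cancel[OF z e2 e4 _ three]) (simp add: z z4')
  then have U2: "b 0 + b 3 - (b 2 + b 5) = 0" using e2 by simp
  have "6 * b 0 = 0" using e0 e3 U1 V1 U2 V2 by Groebner_Basis.algebra
  moreover have "6 * b 1 = 0" using e0 e3 U1 V1 U2 V2 by Groebner_Basis.algebra
  moreover have "6 * b 2 = 0" using e0 e3 U1 V1 U2 V2 by Groebner_Basis.algebra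
  moreover have "6 * b 3 = 0" using e0 e3 U1 V1 U2 V2 by Groebner_Basis.algebra
  moreover have "6 * b 4 = 0" using e0 e3 U1 V1 U2 V2 by Groebner_Basis.algebra
  moreover have "6 * b 5 = 0" using e0 e3 U1 V1 U2 V2 by Groebner_Basis.algebra
  ultimately have "b 0 = 0" "b 1 = 0" "b 2 = 0" "b 3 = 0" "b 4 = 0" "b 5 = 0"
    using char by auto
  moreover have "i \<in> {0, 1, 2, 3, 4, 5}" using \<open>i < 6\<close> by auto
  ultimately show ?thesis by auto
qed

section \<open>Symmetric values of the roots and normality of the sextic\<close>

lemma to_ac_mpeval: "to_ac (mpeval \<rho> P) = mpeval (\<lambda>i. to_ac (\<rho> i)) P"
  by (simp add: mpeval_def to_ac_sum to_ac_prod)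

lemma elem_sym_1: "elem_sym n 1 x = (\<Sum>i<n. x i)"
proof -
  have "{S. S \<subseteq> {..<n} \<and> card S = 1} = (\<lambda>i. {i}) ` {..<n}"
    by (auto simp: card_1_singleton_iff)
  then show ?thesis by (simp add: elem_sym_def sum.reindex)
qed

lemma elem_sym_eq_0: "n < k \<Longrightarrow> elem_sym n k x = 0"
proof -
  assume "n < k"
  then have "card S \<noteq> k" if "S \<subseteq> {..<n}" for S using card_mono[OF _ that] by auto
  then have empty: "{S. S \<subseteq> {..<n} \<and> card S = k} = {}" by blast
  show ?thesis unfolding elem_sym_def empty by simp
qed

text \<open>Both sides are monic of the same degree, so a nonzero difference would have smaller
  degree, yet it vanishes at all \<open>degree p\<close> roots.\<close>

lemma poly_eq_prod_roots:
  fixes p :: "'k::field poly"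
  assumes "Polynomial.lead_coeff p = 1" "card {z. poly p z = 0} = Polynomial.degree p"
  shows "p = (\<Prod>z\<in>{z. poly p z = 0}. [:- z, 1:])"
proof (rule ccontr)
  let ?R = "{z. poly p z = 0}"
  let ?g = "\<Prod>z\<in>?R. [:- z, 1:]"
  assume neq: "p \<noteq> ?g"
  have "p \<noteq> 0" using assms by auto
  have fin: "finite ?R" using \<open>p \<noteq> 0\<close> by (rule poly_roots_finite)
  have deg: "Polynomial.degree ?g = Polynomial.degree p"
    by (subst degree_prod_sum_eq) (auto simp: assms(2))
  have lead: "Polynomial.lead_coeff ?g = 1"
    by (simp add: lead_coeff_prod)
  have "p - ?g \<noteq> 0" using neq by simp
  moreover have "Polynomial.degree (p - ?g) \<le> Polynomial.degree p"
    by (rule degree_diff_le) (simp_all add: deg)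
  moreover have "Polynomial.coeff (p - ?g) (Polynomial.degree p) = 0"
    using assms(1) lead deg by simp
  ultimately have "Polynomial.degree (p - ?g) < Polynomial.degree p"
    by (metis leading_coeff_0_iff order_le_less)
  moreover have "?R \<subseteq> {z. poly (p - ?g) z = 0}"
    using fin by (auto simp: poly_prod)
  then have "card ?R \<le> card {z. poly (p - ?g) z = 0}"
    using \<open>p - ?g \<noteq> 0\<close> by (intro card_mono poly_roots_finite)
  moreover have "card {z. poly (p - ?g) z = 0} \<le> Polynomial.degree (p - ?g)"
    using \<open>p - ?g \<noteq> 0\<close> by (rule card_poly_roots_bound)
  ultimately show False using assms(2) by simp
qed

theorem theorem3p1:
  fixes a :: "'a::{finite, field}" and p :: nat
  assumes "Factorial_Ring.prime p" and "p \<ge> 5" and "CHAR('a) = p"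
    and "Factorial_Ring.irreducible [:a, 0, 0, 0, 0, 1, 1:]"
    and "(\<Prod>m\<in>{2, 3, 6::nat}. mpeval (\<lambda>i. if i = 0 then 1 else if i = 5 then a else 0) (theta 6 m)) \<noteq> 0"
  shows "normal_poly [:a, 0, 0, 0, 0, 1, 1:]"
proof -
  define f where "f = [:a, 0, 0, 0, 0, 1, 1:]"
  define F where "F = map_poly to_ac f"
  define R where "R = {z. poly F z = 0}"
  have F: "F = [:to_ac a, 0, 0, 0, 0, 1, 1:]" by (simp add: F_def f_def map_poly_pCons)
  have deg: "Polynomial.degree f = 6" "Polynomial.degree F = 6" by (simp_all add: f_def F)
  obtain r where r: "poly F r = 0"
    using alg_closed_imp_poly_has_root[of F] deg by auto
  define y where "y i = r ^ (CARD('a) ^ i)" for i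
  \<comment> \<open>The sign turns the factors \<open>X - y i\<close> into \<open>X + x i\<close>,
    so that \<open>vieta\<close> reads off the coefficients of \<open>f\<close> without
    signs.\<close>
  define x where "x i = - y i" for i
  have irred: "Factorial_Ring.irreducible f" using assms(4) by (simp add: f_def)
  have bij: "bij_betw y {..<6} R" and periodic: "y (i + 6) = y i" for i
    using frobenius_orbit_of_root[OF irred r[unfolded F_def]] unfolding deg R_def F_def y_def by auto
  have cardR: "card R = 6" using bij_betw_same_card[OF bij] by simp
  have lead: "Polynomial.lead_coeff F = 1" by (simp add: F)
  have "F = (\<Prod>z\<in>R. [:- z, 1:])"
    by (rule poly_eq_prod_roots[of F, folded R_def, OF lead]) (simp add: cardR deg)
  also have "\<dots> = (\<Prod>i<6. [:x i, 1:])"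
    unfolding x_def by (rule prod.reindex_bij_betw[OF bij, symmetric])
  finally have F_prod: "F = (\<Prod>i<6. [:x i, 1:])" .
  \<comment> \<open>Index \<open>i\<close> stands for the symmetric function of index
    \<open>i + 1\<close>: the value 1 comes from \<open>X^5\<close> and \<open>a\<close> from the
    constant term. From index 6 on both sides vanish.\<close>
  have sym: "elem_sym 6 (i + 1) x = to_ac (if i = 0 then 1 else if i = 5 then a else 0)" for i
  proof (cases "i < 6")
    case True
    then have "i \<in> {0, 1, 2, 3, 4, 5}" by auto
    then show ?thesis
      using vieta[of "i + 1" 6 x] unfolding F_prod[symmetric] F by (auto simp: coeff_pCons)
  qed (simp add: elem_sym_eq_0)
  have theta_nz: "mpeval (\<lambda>i. elem_sym 6 (i + 1) x) (theta 6 m) \<noteq> 0" if "m \<in> {2, 3, 6}" for m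
    using assms(5) that unfolding sym to_ac_mpeval[symmetric] by auto
  have nz: "(\<Sum>j<6. c ^ j * x j) \<noteq> 0" if "c ^ 6 = 1" for c
  proof -
    \<comment> \<open>The factorization of \<open>c ^ 6 - 1\<close> into the cyclotomic polynomials
      of orders 1, 2, 3 and 6.\<close>
    have "(c - 1) * (c + 1) * (c ^ 2 + c + 1) * (c ^ 2 - c + 1) = 0"
      using that by Groebner_Basis.algebra
    then consider "c - 1 = 0" | "c + 1 = 0" | "c ^ 2 + c + 1 = 0" | "c ^ 2 - c + 1 = 0"
      unfolding mult_eq_0_iff by blast
    then show ?thesis
    proof cases
      case 1
      then show ?thesis using sym[of 0] elem_sym_1[of 6 x] by simp
    next
      case 2
      then have "c = -1" by Groebner_Basis.algebra
      then show ?thesis using alternating_sum_dvd_theta_6_2[of x] theta_nz[of 2] by auto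
    next
      case 3
      then have "c ^ 2 = - 1 - c" by Groebner_Basis.algebra
      then show ?thesis using cubic_sum_dvd_theta_6_3[of c x] theta_nz[of 3] by auto
    next
      case 4
      then have "c ^ 2 = c - 1" by Groebner_Basis.algebra
      then show ?thesis using sextic_sum_dvd_theta_6_6[of c x] theta_nz[of 6] by auto
    qed
  qed
  have six: "(6 :: 'a alg_closure) \<noteq> 0"
  proof
    assume "(6 :: 'a alg_closure) = 0"
    then have "of_nat 6 = (0 :: 'a alg_closure)" by simp
    then have "p dvd 6" using assms(3) by (simp only: of_nat_eq_0_iff_char_dvd CHAR_alg_closure)
    then have "p \<le> 6" by (rule dvd_imp_le) simp
    then have "p = 5 \<or> p = 6" using assms(2) by auto
    moreover have "p \<noteq> 6"
    proof
      assume "p = 6"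
      then show False using prime_product[of 2 3] assms(1) by simp
    qed
    ultimately show False using \<open>p dvd 6\<close> by auto
  qed
  have "c z = 0" if lin: "(\<Sum>z\<in>R. to_ac (c z) * z) = 0" and "z \<in> R" for c :: "'a alg_closure \<Rightarrow> 'a" and z
  proof -
    define b where "b i = to_ac (c (y i))" for i
    have b_frob: "b i ^ CARD('a) = b i" for i by (simp add: b_def frobenius_fixed_iff)
    have y_Suc: "y (Suc i) = y i ^ CARD('a)" for i
      by (simp add: y_def mult.commute flip: power_mult)
    \<comment> \<open>Raising relation \<open>k\<close> to the power \<open>CARD('a)\<close> gives
      relation \<open>k + 1\<close>, since each \<open>b i\<close> is fixed by Frobenius.\<close>
    have conv: "(\<Sum>i<6. b i * y (i + k)) = 0" for k
    proof (induction k)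
      case 0
      then show ?case
        using lin sum.reindex_bij_betw[OF bij, of "\<lambda>z. to_ac (c z) * z"] by (simp add: b_def)
    next
      case (Suc k)
      have "(\<Sum>i<6. b i * y (i + Suc k)) = (\<Sum>i<6. b i * y (i + k)) ^ CARD('a)"
        by (simp add: frobenius_sum power_mult_distrib b_frob y_Suc)
      then show ?case using Suc by (simp add: power_0_left)
    qed
    obtain i where i: "i < 6" "z = y i" using bij \<open>z \<in> R\<close> by (auto simp: bij_betw_def)
    have "b i = 0"
    proof (rule cyclic_convolution_6_injective[of b x, OF _ _ nz six i(1)])
      show "(\<Sum>i<6. b i * x (i + k)) = 0" for k using conv[of k] by (simp add: x_def sum_negf)
    qed (simp_all add: x_def periodic)
    then show ?thesis by (simp add: b_def i)
  qed
  then show ?thesis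
    unfolding normal_poly_def f_def[symmetric] F_def[symmetric] R_def[symmetric] Let_def
    using irred cardR deg by (auto simp: f_def)
qed

end
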